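(* Let $C\in\mathcal{C}_d$ be a closed convex cone, and let $g$ be a standard Gaussian vector in $\mathbb{R}^d$. Then $$\operatorname{Var}[V_C]=\operatorname{Var}\big[\|\Pi_C(g)\|^2\big]-2\delta(C)=\operatorname{Var}\big[\|\Pi_{C^\circ}(g)\|^2\big]-2\delta(C^\circ)=\operatorname{Var}[V_{C^\circ}].$$
   Context: $\mathbb{R}^d$ carries the standard inner product $\langle\cdot,\cdot\rangle$ and Euclidean norm $\|\cdot\|$. Cones. A convex cone $C\subset\mathbb{R}^d$ is a nonempty set with $\tau(x+y)\in C$ for all $\tau>0$, $x,y\in C$; $\mathcal{C}_d$ is the set of closed convex cones in $\mathbb{R}^d$. The polar cone is $C^\circ=\{u\in\mathbb{R}^d:\langle u,x\rangle\le 0 \text{ for all } x\in C\}\in\mathcal{C}_d$. The metric projector onto $C$ is $\Pi_C(x)=\arg\min\{\|x-y\|^2:y\in C\}$. A cone is polyhedral if it is a finite intersection of halfspaces $\{x:\langle u_i,x\rangle\ge0\}$. A face of a polyhedral cone $C$ is a set of the form $\{x\in C:\langle u,x\rangle=\sup_{y\in C}\langle u,y\rangle\}$ with $u\in C^\circ$; its dimension is the dimension of its linear hull, and its relative interior is its interior relative to its linear hull. Conic Hausdorff metric. For nonzero $x,y$ put $\mathrm{dist}_s(x,y)=\arccos\big(\langle x,y\rangle/(\|x\|\|y\|)\big)$, with $\mathrm{dist}_s(0,0)=0$ and $\mathrm{dist}_s(x,0)=\mathrm{dist}_s(0,x)=\pi/2$ for $x\ne0$. Put $\mathcal{T}_s(C,\alpha)=\{x\in\mathbb{R}^d:\mathrm{dist}_s(x,y)\le\alpha\text{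 for some }y\in C\}$. The conic Hausdorff metric on $\mathcal{C}_d$ is $\mathrm{dist}_{\mathcal H}(C_1,C_2)=\inf\{\alpha\ge0:\mathcal{T}_s(C_1,\alpha)\supset C_2\text{ and }\mathcal{T}_s(C_2,\alpha)\supset C_1\}$. Conic intrinsic volumes. For polyhedral $C\in\mathcal{C}_d$ and $k=0,\dots,d$, $v_k(C)=\mathbb{P}\{\Pi_C(g)\text{ lies in the relative interior of a }k\text{-dimensional face of }C\}$, with $g$ a standard Gaussian vector in $\mathbb{R}^d$. For general $C\in\mathcal{C}_d$, $v_k(C)=\lim_{i\to\infty}v_k(C_i)$ for any sequence of polyhedral cones $C_i\in\mathcal{C}_d$ with $C_i\to C$ in the conic Hausdorff metric (polyhedral cones are dense, and the limit exists and does not depend on the sequence). The numbers $v_0(C),\dots,v_d(C)$ are nonnegative and sum to one. The intrinsic volume random variable $V_C$ has distribution $\mathbb{P}\{V_C=k\}=v_k(C)$ for $k=0,1,\dots,d$. The statistical dimension is $\delta(C):=\mathbb{E}[V_C]=\sum_{k=0}^d k\,v_k(C)$. *)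

theory Defs
  imports "HOL-Probability.Probability"
begin

section \<open>Closed convex cones, polars, polyhedral cones\<close>

definition closed_convex_cone :: "'a::euclidean_space set \<Rightarrow> bool" where
  "closed_convex_cone C \<longleftrightarrow>
     closed C \<and> C \<noteq> {} \<and> (\<forall>\<tau>>0. \<forall>x\<in>C. \<forall>y\<in>C. \<tau> *\<^sub>R (x + y) \<in> C)"

text \<open>For closed sets this agrees with the library notion, which requires the apex to belong to
  the cone.\<close>

lemma closed_convex_cone_iff: "closed_convex_cone C \<longleftrightarrow> closed C \<and> convex_cone C"
proof
  assume C: "closed_convex_cone C"
  have cl: "closed C" and ne: "C \<noteq> {}"
    and tau: "\<And>\<tau> x y. \<tau> > 0 \<Longrightarrow> x \<in> C \<Longrightarrow> y \<in> C \<Longrightarrow> \<tau> *\<^sub>R (x + y) \<in> C"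
    using C by (auto simp: closed_convex_cone_def)
  have scale: "c *\<^sub>R x \<in> C" if "c > 0" "x \<in> C" for c x
    using tau[of "c / 2" x x] that by (simp flip: scaleR_2)
  obtain x where x: "x \<in> C" using ne by blast
  have lim: "(\<lambda>n. inverse (real (Suc n)) *\<^sub>R x) \<longlonglongrightarrow> 0 *\<^sub>R x"
    by (intro tendsto_intros LIMSEQ_inverse_real_of_nat)
  have "inverse (real (Suc n)) *\<^sub>R x \<in> C" for n
    by (rule scale[OF _ x]) simp
  then have "0 *\<^sub>R x \<in> C"
    using closed_sequentially[OF cl _ lim] by blast
  then have zero: "0 \<in> C" by simp
  have scale': "c *\<^sub>R x \<in> C" if "c \<ge> 0" "x \<in> C" for c x
    using scale zero that by (cases "c = 0") auto
  show "closed C \<and> convex_cone C"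
    using cl zero scale' tau[of 1] by (auto simp: convex_cone_iff)
next
  assume "closed C \<and> convex_cone C"
  then show "closed_convex_cone C"
    by (auto simp: closed_convex_cone_def convex_cone_iff)
qed

definition polar_cone :: "'a::euclidean_space set \<Rightarrow> 'a set" where
  "polar_cone C = {u. \<forall>x\<in>C. u \<bullet> x \<le> 0}"

definition polyhedral_cone :: "'a::euclidean_space set \<Rightarrow> bool" where
  "polyhedral_cone C \<longleftrightarrow> (\<exists>U. finite U \<and> C = (\<Inter>u\<in>U. {x. u \<bullet> x \<ge> 0}))"

definition cone_face :: "'a::euclidean_space set \<Rightarrow> 'a set \<Rightarrow> bool" where
  "cone_face F C \<longleftrightarrow> (\<exists>u\<in>polar_cone C. F = {x\<in>C. u \<bullet> x = (SUP y\<in>C. u \<bullet> y)})"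

section \<open>The conic Hausdorff metric\<close>

definition angular_dist :: "'a::euclidean_space \<Rightarrow> 'a \<Rightarrow> real" where
  "angular_dist x y =
     (if x = 0 \<and> y = 0 then 0
      else if x = 0 \<or> y = 0 then pi / 2
      else arccos (x \<bullet> y / (norm x * norm y)))"

definition angular_expansion :: "'a::euclidean_space set \<Rightarrow> real \<Rightarrow> 'a set" where
  "angular_expansion C \<alpha> = {x. \<exists>y\<in>C. angular_dist x y \<le> \<alpha>}"

definition conic_hausdorff_dist :: "'a::euclidean_space set \<Rightarrow> 'a set \<Rightarrow> real" where
  "conic_hausdorff_dist C1 C2 =
     Inf {\<alpha>. \<alpha> \<ge> 0 \<and> C2 \<subseteq> angular_expansion C1 \<alpha> \<and> C1 \<subseteq> angular_expansion C2 \<alpha>}"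

section \<open>Standard Gaussian vectors\<close>

definition std_gaussian_density :: "'a::euclidean_space \<Rightarrow> ennreal" where
  "std_gaussian_density x = (\<Prod>b\<in>Basis. ennreal (std_normal_density (x \<bullet> b)))"

definition std_gaussian :: "'a::euclidean_space measure" where
  "std_gaussian = density lborel std_gaussian_density"

section \<open>Conic intrinsic volumes and the statistical dimension\<close>

text \<open>Faces of a polyhedral cone contain the origin, so the affine hull underlying
  \<^const>\<open>rel_interior\<close> is the linear hull. The metric projector onto \<open>C\<close> is
  \<^term>\<open>closest_point C\<close>.\<close>

definition polyhedral_intrinsic_volume :: "'a::euclidean_space set \<Rightarrow> nat \<Rightarrow> real" where
  "polyhedral_intrinsic_volume C k =
     measure std_gaussian
       {x. \<exists>F. cone_face F C \<and> dim F = k \<and> closest_point C x \<in> rel_interior F}"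

definition intrinsic_volume :: "'a::euclidean_space set \<Rightarrow> nat \<Rightarrow> real" where
  "intrinsic_volume C k =
     (if polyhedral_cone C then polyhedral_intrinsic_volume C k
      else (THE v. \<forall>P :: nat \<Rightarrow> 'a set.
              (\<forall>i. polyhedral_cone (P i)) \<and> (\<lambda>i. conic_hausdorff_dist (P i) C) \<longlonglongrightarrow> 0
              \<longrightarrow> (\<lambda>i. polyhedral_intrinsic_volume (P i) k) \<longlonglongrightarrow> v))"

text \<open>The distribution of \<open>V\<^sub>C\<close>. As \<^const>\<open>embed_pmf\<close> is meaningful only for nonnegative weights of
  total mass one, this relies on the intrinsic volumes of a closed convex cone having these
  properties.\<close>

definition intrinsic_volume_pmf :: "'a::euclidean_space set \<Rightarrow> nat pmf" where
  "intrinsic_volume_pmf C =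
     embed_pmf (\<lambda>k. if k \<le> DIM('a) then intrinsic_volume C k else 0)"

definition stat_dim :: "'a::euclidean_space set \<Rightarrow> real" where
  "stat_dim C = measure_pmf.expectation (intrinsic_volume_pmf C) real"

end

theory Submission
  imports Defs "HOL-Real_Asymp.Real_Asymp"
begin

text \<open>Everything is read off the Laplace transform
  \<open>E exp (- s |\<Pi>\<^sub>C g|\<^sup>2 - t |g - \<Pi>\<^sub>C g|\<^sup>2) = (\<Sum>k. v\<^sub>k(C) (1 + 2s) powr (-k/2) (1 + 2t) powr (-(d-k)/2))\<close>.
  For a polyhedral cone, split the space according to the face whose relative interior contains the projection:
  the piece belonging to a \<open>k\<close>-dimensional face is invariant under independent scalings of the span of
  the face and of its orthogonal complement, so that a linear change of variables evaluates the integral over it.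
  Convergence of cones in the conic Hausdorff metric implies pointwise convergence of the projections,
  hence of the left-hand side, and a polynomial of bounded degree has its coefficients determined continuously
  by its values; so the identity passes to all closed convex cones. Comparing second-order behaviour at
  \<open>s = 0\<close> gives \<open>E |\<Pi>\<^sub>C g|\<^sup>2 = E V\<close> and \<open>E |\<Pi>\<^sub>C g|\<^sup>4 = E V(V+2)\<close>, and at \<open>t = 0\<close> the same
  for \<open>g - \<Pi>\<^sub>C g\<close>, which is the projection onto the polar cone, with \<open>d - V\<close> in place of \<open>V\<close>.\<close>

section \<open>Gaussian density and linear changes of variables\<close>

lemma std_gaussian_density_eq:
  "std_gaussian_density (x::'a::euclidean_space) =
     ennreal ((1 / sqrt (2 * pi)) ^ DIM('a) * exp (- (norm x)\<^sup>2 / 2))"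
proof -
  have "std_gaussian_density x = ennreal (\<Prod>b\<in>Basis. std_normal_density (x \<bullet> b))"
    by (simp add: std_gaussian_density_def prod_ennreal)
  also have "(\<Prod>b\<in>Basis. std_normal_density (x \<bullet> b))
      = (1 / sqrt (2 * pi)) ^ DIM('a) * exp (\<Sum>b\<in>Basis. - (x \<bullet> b)\<^sup>2 / 2)"
    by (simp add: std_normal_density_def exp_sum prod.distrib prod_dividef power_divide flip: prod_constant)
  also have "(\<Sum>b\<in>Basis. - (x \<bullet> b)\<^sup>2 / 2) = - (norm x)\<^sup>2 / 2"
    by (subst euclidean_inner[of x x, folded power2_norm_eq_inner])
       (simp add: sum_negf sum_divide_distrib power2_eq_square flip: sum_divide_distrib)
  finally show ?thesis .
qed

lemma borel_measurable_std_gaussian_density [measurable]: "std_gaussian_density \<in> borel_measurable borel"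
  unfolding std_gaussian_density_def by measurable

lemma std_gaussian_density_cong:
  fixes x y :: "'a::euclidean_space"
  shows "norm x = norm y \<Longrightarrow> std_gaussian_density x = std_gaussian_density y"
  by (simp add: std_gaussian_density_eq)

lemma nn_integral_std_gaussian_density: "(\<integral>\<^sup>+x. std_gaussian_density (x::'a::euclidean_space) \<partial>lborel) = 1"
proof -
  have "(\<integral>\<^sup>+x. ennreal (std_normal_density x) \<partial>lborel) = 1"
    by (subst nn_integral_eq_integral) auto
  then show ?thesis
    unfolding std_gaussian_density_def
    by (subst nn_integral_lborel_prod) auto
qed

lemma sets_std_gaussian [measurable_cong, simp]: "sets std_gaussian = sets borel"
  by (simp add: std_gaussian_def)

lemma space_std_gaussian [simp]: "space std_gaussian = UNIV"
  by (simp add: std_gaussian_def)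

lemma prob_space_std_gaussian: "prob_space (std_gaussian :: 'a::euclidean_space measure)"
  by (rule prob_spaceI)
     (simp add: std_gaussian_def emeasure_density nn_integral_std_gaussian_density)

section \<open>Invariance of Lebesgue measure under translations, reflections and rotations\<close>

lemma nn_integral_lborel_translate:
  fixes f :: "'a::euclidean_space \<Rightarrow> ennreal"
  assumes [measurable]: "f \<in> borel_measurable borel"
  shows "(\<integral>\<^sup>+x. f (a + x) \<partial>lborel) = (\<integral>\<^sup>+x. f x \<partial>lborel)"
  by (subst (2) lborel_affine[of 1 a]) (simp_all add: nn_integral_density nn_integral_distr)

lemma nn_integral_lborel_reflect:
  fixes f :: "'a::euclidean_space \<Rightarrow> ennreal"
  assumes [measurable]: "f \<in> borel_measurable borel"
  shows "(\<integral>\<^sup>+x. f (a - x) \<partial>lborel) = (\<integral>\<^sup>+x. f x \<partial>lborel)"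
  by (subst (2) lborel_affine[of "-1" a]) (simp_all add: nn_integral_density nn_integral_distr)

lemma borel_measurable_orthogonal_transformation:
  fixes R :: "'a::euclidean_space \<Rightarrow> 'a"
  shows "orthogonal_transformation R \<Longrightarrow> R \<in> borel_measurable borel"
  by (intro borel_measurable_continuous_onI linear_continuous_on linear_conv_bounded_linear[THEN iffD1])
     (rule orthogonal_transformation_linear)

text \<open>Convolving with the rotation invariant Gaussian density turns invariance under translations into
  invariance under rotations.\<close>

lemma nn_integral_lborel_orthogonal:
  fixes f :: "'a::euclidean_space \<Rightarrow> ennreal" and R :: "'a \<Rightarrow> 'a"
  assumes R: "orthogonal_transformation R" and f [measurable]: "f \<in> borel_measurable borel"
  shows "(\<integral>\<^sup>+x. f (R x) \<partial>lborel) = (\<integral>\<^sup>+x. f x \<partial>lborel)"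
proof -
  let ?\<phi> = "std_gaussian_density :: 'a \<Rightarrow> ennreal"
  have lin: "linear R" by (rule orthogonal_transformation_linear[OF R])
  have [measurable]: "R \<in> borel_measurable borel"
    by (rule borel_measurable_orthogonal_transformation[OF R])
  have RR: "R (inv R y) = y" for y
    by (rule surj_f_inv_f[OF orthogonal_transformation_surj[OF R]])
  have 1: "(\<integral>\<^sup>+x. f (R x) \<partial>lborel) = (\<integral>\<^sup>+x. f (R x + y) \<partial>lborel)" for y
  proof -
    have "(\<integral>\<^sup>+x. f (R x) \<partial>lborel) = (\<integral>\<^sup>+x. f (R (inv R y + x)) \<partial>lborel)"
      by (rule nn_integral_lborel_translate[symmetric]) measurable
    then show ?thesis by (simp add: linear_add[OF lin] RR add.commute)
  qed
  \<comment> \<open>Rotation invariance of the density enters here: |z - R x| equals the distance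
    from x to the preimage of z, so a reflection and a translation reduce the integral to the total
    Gaussian mass.\<close>
  have 2: "(\<integral>\<^sup>+x. ?\<phi> (z - R x) \<partial>lborel) = 1" for z
  proof -
    have "norm (z - R x) = norm (inv R z - x)" for x
    proof -
      have "z - R x = R (inv R z - x)" by (simp add: linear_diff[OF lin] RR)
      then show ?thesis by (simp add: orthogonal_transformation_norm[OF R])
    qed
    then have "(\<integral>\<^sup>+x. ?\<phi> (z - R x) \<partial>lborel) = (\<integral>\<^sup>+x. ?\<phi> (inv R z - x) \<partial>lborel)"
      by (intro nn_integral_cong std_gaussian_density_cong)
    then show ?thesis
      by (simp add: nn_integral_lborel_reflect nn_integral_std_gaussian_density)
  qed
  have "(\<integral>\<^sup>+x. f (R x) \<partial>lborel) = (\<integral>\<^sup>+y. ?\<phi> y * (\<integral>\<^sup>+x. f (R x) \<partial>lborel) \<partial>lborel)"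
    by (simp add: nn_integral_multc nn_integral_std_gaussian_density)
  also have "\<dots> = (\<integral>\<^sup>+y. ?\<phi> y * (\<integral>\<^sup>+x. f (R x + y) \<partial>lborel) \<partial>lborel)"
    using 1 by simp
  also have "\<dots> = (\<integral>\<^sup>+y. (\<integral>\<^sup>+x. ?\<phi> y * f (R x + y) \<partial>lborel) \<partial>lborel)"
    by (intro nn_integral_cong nn_integral_cmult[symmetric]) measurable
  also have "\<dots> = (\<integral>\<^sup>+x. (\<integral>\<^sup>+y. ?\<phi> y * f (R x + y) \<partial>lborel) \<partial>lborel)"
    by (rule lborel_pair.Fubini') measurable
  also have "\<dots> = (\<integral>\<^sup>+x. (\<integral>\<^sup>+z. ?\<phi> (z - R x) * f z \<partial>lborel) \<partial>lborel)"
  proof (rule nn_integral_cong)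
    fix x
    have "(\<integral>\<^sup>+z. ?\<phi> (z - R x) * f z \<partial>lborel) = (\<integral>\<^sup>+y. ?\<phi> ((R x + y) - R x) * f (R x + y) \<partial>lborel)"
      by (rule nn_integral_lborel_translate[symmetric]) measurable
    then show "(\<integral>\<^sup>+y. ?\<phi> y * f (R x + y) \<partial>lborel) = (\<integral>\<^sup>+z. ?\<phi> (z - R x) * f z \<partial>lborel)"
      by simp
  qed
  also have "\<dots> = (\<integral>\<^sup>+z. (\<integral>\<^sup>+x. ?\<phi> (z - R x) * f z \<partial>lborel) \<partial>lborel)"
    by (rule lborel_pair.Fubini') measurable
  also have "\<dots> = (\<integral>\<^sup>+z. f z \<partial>lborel)"
    by (simp add: nn_integral_multc 2)
  finally show ?thesis .
qed

section \<open>Scaling a subspace and its orthogonal complement independently\<close>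

lemma dim_orthogonal_complement:
  fixes L :: "'a::euclidean_space set"
  assumes "subspace L"
  shows "dim {z. \<forall>w\<in>L. z \<bullet> w = 0} = DIM('a) - dim L"
proof -
  have "dim {y \<in> UNIV. \<forall>x\<in>L. orthogonal x y} + dim L = dim (UNIV :: 'a set)"
    by (rule dim_subspace_orthogonal_to_vectors) (use assms in auto)
  moreover have "{y \<in> UNIV. \<forall>x\<in>L. orthogonal x y} = {z. \<forall>w\<in>L. z \<bullet> w = 0}"
    by (auto simp: orthogonal_def inner_commute)
  ultimately show ?thesis by simp
qed

text \<open>Some orthogonal \<open>R\<close> carries a coordinate subspace of dimension
  \<open>dim L\<close> onto \<open>L\<close> and the complementary coordinate subspace onto the
  orthogonal complement of \<open>L\<close>. Conjugating a diagonal map \<open>D\<close> by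
  \<open>R\<close> gives \<open>T\<close>; as \<open>R\<close> preserves Lebesgue measure, only the
  determinant of \<open>D\<close> appears.\<close>

lemma nn_integral_lborel_scale_subspace:
  fixes L :: "'a::euclidean_space set"
  assumes L: "subspace L" and a: "a > 0" and b: "b > 0"
  obtains T :: "'a \<Rightarrow> 'a" where
    "\<And>y z. y \<in> L \<Longrightarrow> (\<And>w. w \<in> L \<Longrightarrow> z \<bullet> w = 0) \<Longrightarrow> T (y + z) = a *\<^sub>R y + b *\<^sub>R z"
    "T \<in> borel_measurable borel"
    "\<And>f. f \<in> borel_measurable borel \<Longrightarrow>
       (\<integral>\<^sup>+x. f x \<partial>lborel) = ennreal (a ^ dim L * b ^ (DIM('a) - dim L)) * (\<integral>\<^sup>+x. f (T x) \<partial>lborel)"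
proof -
  define N where "N = {z. \<forall>w\<in>L. z \<bullet> w = 0}"
  have N: "subspace N" by (auto simp: N_def subspace_def inner_add_left)
  have dN: "dim N = DIM('a) - dim L"
    unfolding N_def by (rule dim_orthogonal_complement[OF L])
  obtain B :: "'a set" where B: "B \<subseteq> Basis" "card B = dim L"
    using obtain_subset_with_card_n[OF dim_subset_UNIV[of L]] by blast
  have fB: "finite B" using B finite_Basis finite_subset by blast
  have iB: "independent B" "independent (Basis - B)"
    using B independent_Basis independent_mono by (blast, blast)
  have dB: "dim (span B) = dim L" "dim (span (Basis - B)) = dim N"
    using B fB by (simp_all add: dim_eq_card_independent[OF iB(1)] dim_eq_card_independent[OF iB(2)] dN card_Diff_subset)
  obtain f1 g1 where f1: "linear f1" "f1 ` span B = L" "\<And>x. x \<in> span B \<Longrightarrow> norm (f1 x) = norm x"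
    using isometries_subspaces[OF subspace_span L dB(1)] by metis
  obtain f2 g2 where f2: "linear f2" "f2 ` span (Basis - B) = N" "\<And>x. x \<in> span (Basis - B) \<Longrightarrow> norm (f2 x) = norm x"
    using isometries_subspaces[OF subspace_span N dB(2)] by metis
  define p where "p x = (\<Sum>b\<in>B. (x \<bullet> b) *\<^sub>R b)" for x :: 'a
  define q where "q x = (\<Sum>b\<in>Basis - B. (x \<bullet> b) *\<^sub>R b)" for x :: 'a
  have pq: "p x + q x = x" for x
    unfolding p_def q_def
    using sum.subset_diff[OF B(1) finite_Basis, of "\<lambda>b. (x \<bullet> b) *\<^sub>R b"]
    by (simp add: euclidean_representation add.commute)
  have pin: "p x \<in> span B" for x unfolding p_def by (intro span_sum span_mul span_base)
  have qin: "q x \<in> span (Basis - B)" for x unfolding q_def by (intro span_sum span_mul span_base)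
  have plin: "linear p" "linear q"
    unfolding p_def q_def by (auto intro!: linearI simp: inner_add_left scaleR_add_left sum.distrib scaleR_sum_right)
  have porth: "p x \<bullet> q x = 0" for x
    unfolding p_def q_def inner_sum_left inner_sum_right
    by (intro sum.neutral ballI) (use B in \<open>auto simp: inner_Basis subset_iff\<close>)
  define R where "R x = f1 (p x) + f2 (q x)" for x
  have Rlin: "linear R"
    unfolding R_def
    by (intro linear_compose_add linear_compose[unfolded o_def, OF plin(1) f1(1)]
          linear_compose[unfolded o_def, OF plin(2) f2(1)])
  have f1L: "f1 (p x) \<in> L" for x using f1(2) pin by blast
  have f2N: "f2 (q x) \<in> N" for x using f2(2) qin by blast
  have "norm (R x) = norm x" for x
  proof -
    have "f1 (p x) \<bullet> f2 (q x) = 0" using f1L[of x] f2N[of x] by (auto simp: N_def inner_commute)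
    then have "(norm (R x))\<^sup>2 = (norm (f1 (p x)))\<^sup>2 + (norm (f2 (q x)))\<^sup>2"
      unfolding R_def by (intro norm_add_Pythagorean) (simp add: orthogonal_def)
    also have "\<dots> = (norm (p x))\<^sup>2 + (norm (q x))\<^sup>2" using f1(3)[OF pin] f2(3)[OF qin] by simp
    also have "\<dots> = (norm (p x + q x))\<^sup>2"
      using porth by (intro norm_add_Pythagorean[symmetric]) (simp add: orthogonal_def)
    finally show ?thesis by (simp add: pq)
  qed
  with Rlin have R: "orthogonal_transformation R" by (simp add: orthogonal_transformation)
  define c where "c j = (if j \<in> B then a else b)" for j
  define D where "D x = (\<Sum>j\<in>Basis. (c j * (x \<bullet> j)) *\<^sub>R j)" for x :: 'a
  have Dpq: "D x = a *\<^sub>R p x + b *\<^sub>R q x" for x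
    unfolding D_def sum.subset_diff[OF B(1) finite_Basis] p_def q_def
    by (simp add: c_def scaleR_sum_right add.commute)
  have Dm [measurable]: "D \<in> borel_measurable borel" unfolding D_def by measurable
  have Rm [measurable]: "R \<in> borel_measurable borel" "inv R \<in> borel_measurable borel"
    using borel_measurable_orthogonal_transformation[OF R]
      borel_measurable_orthogonal_transformation[OF orthogonal_transformation_inv[OF R]] by auto
  have prodc: "(\<Prod>j\<in>Basis. \<bar>c j\<bar>) = a ^ dim L * b ^ (DIM('a) - dim L)"
    unfolding prod.subset_diff[OF B(1) finite_Basis]
    using a b B fB by (simp add: c_def card_Diff_subset mult.commute)
  show thesis
  proof (rule that[of "R \<circ> D \<circ> inv R"])
    fix y z assume y: "y \<in> L" and z: "\<And>w. w \<in> L \<Longrightarrow> z \<bullet> w = 0"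
    define x where "x = inv R (y + z)"
    have Rx: "R x = y + z"
      unfolding x_def by (rule surj_f_inv_f[OF orthogonal_transformation_surj[OF R]])
    \<comment> \<open>Uniqueness of the orthogonal decomposition: the two sides lie in
      \<open>L\<close> and in \<open>N\<close>, so the common vector is orthogonal to
      itself.\<close>
    have "f1 (p x) - y = z - f2 (q x)" using Rx by (simp add: R_def algebra_simps)
    moreover have "f1 (p x) - y \<in> L" using f1L y L by (simp add: subspace_diff)
    moreover have "z - f2 (q x) \<in> N" using f2N z N by (auto intro: subspace_diff simp: N_def inner_diff_left)
    ultimately have "(f1 (p x) - y) \<bullet> (f1 (p x) - y) = 0" by (auto simp: N_def)
    then have y': "f1 (p x) = y" by simp
    with Rx have z': "f2 (q x) = z" by (simp add: R_def)
    have "p (p x) = p x" "q (p x) = 0" "p (q x) = 0" "q (q x) = q x"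
    proof -
      \<comment> \<open>Vectors in the span of some coordinate vectors have no components along the
        other ones; hence \<open>p\<close> and \<open>q\<close> annihilate each other's
        range.\<close>
      have *: "u \<bullet> b = 0" if "u \<in> span S" "S \<subseteq> Basis" "b \<in> Basis - S" for u b and S :: "'a set"
        using that(1)
      proof (induction rule: span_induct_alt)
        case (step c x y) then show ?case using that inner_not_same_Basis[of x b] by (auto simp: inner_add_left)
      qed simp
      show 1: "q (p x) = 0" "p (q x) = 0"
        unfolding q_def[of "p x"] p_def[of "q x"]
        by (intro sum.neutral ballI; use *[OF pin[of x]] *[OF qin[of x]] B in auto)+
      show "p (p x) = p x" "q (q x) = q x" using pq[of "p x"] pq[of "q x"] 1 by auto
    qed
    then have "p (D x) = a *\<^sub>R p x" "q (D x) = b *\<^sub>R q x"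
      by (simp_all add: Dpq linear_add[OF plin(1)] linear_add[OF plin(2)] linear_cmul[OF plin(1)] linear_cmul[OF plin(2)])
    then show "(R \<circ> D \<circ> inv R) (y + z) = a *\<^sub>R y + b *\<^sub>R z"
      using y' z' by (simp add: x_def[symmetric] R_def linear_cmul[OF f1(1)] linear_cmul[OF f2(1)])
  next
    show "R \<circ> D \<circ> inv R \<in> borel_measurable borel" by measurable
  next
    fix f :: "'a \<Rightarrow> ennreal" assume f [measurable]: "f \<in> borel_measurable borel"
    have cnz: "c j \<noteq> 0" for j using a b by (simp add: c_def)
    have "(\<integral>\<^sup>+x. f x \<partial>lborel) = (\<integral>\<^sup>+x. f (R x) \<partial>lborel)"
      by (rule nn_integral_lborel_orthogonal[OF R, symmetric]) measurable
    also have "\<dots> = ennreal (\<Prod>j\<in>Basis. \<bar>c j\<bar>) * (\<integral>\<^sup>+x. f (R (D x)) \<partial>lborel)"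
      by (subst lborel_affine_euclidean[of c 0])
         (use cnz in \<open>simp_all add: D_def[symmetric] nn_integral_density nn_integral_distr nn_integral_cmult\<close>)
    also have "(\<integral>\<^sup>+x. f (R (D x)) \<partial>lborel) = (\<integral>\<^sup>+x. f (R (D (inv R x))) \<partial>lborel)"
      by (rule nn_integral_lborel_orthogonal[OF orthogonal_transformation_inv[OF R], symmetric]) measurable
    finally show "(\<integral>\<^sup>+x. f x \<partial>lborel) = ennreal (a ^ dim L * b ^ (DIM('a) - dim L)) *
        (\<integral>\<^sup>+x. f ((R \<circ> D \<circ> inv R) x) \<partial>lborel)"
      by (simp add: prodc)
  qed
qed

section \<open>Projections onto cones and faces of polyhedral cones\<close>

lemma closed_convex_coneD:
  assumes "closed_convex_cone C"
  shows "closed C" "convex C" "C \<noteq> {}" "0 \<in> C"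
    "\<And>x y. x \<in> C \<Longrightarrow> y \<in> C \<Longrightarrow> x + y \<in> C"
    "\<And>c x. 0 \<le> c \<Longrightarrow> x \<in> C \<Longrightarrow> c *\<^sub>R x \<in> C"
proof -
  have C: "closed C" "convex_cone C"
    using assms by (simp_all add: closed_convex_cone_iff)
  show "closed C" by fact
  show "convex C" "C \<noteq> {}" using C(2) by (simp_all add: convex_cone_def)
  show "0 \<in> C" "\<And>x y. x \<in> C \<Longrightarrow> y \<in> C \<Longrightarrow> x + y \<in> C"
    "\<And>c x. 0 \<le> c \<Longrightarrow> x \<in> C \<Longrightarrow> c *\<^sub>R x \<in> C"
    using C(2) by (simp_all add: convex_cone_iff)
qed

lemma closest_point_cone:
  fixes x :: "'a::euclidean_space"
  assumes C: "closed_convex_cone C"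
  shows "closest_point C x \<in> C"
    "(x - closest_point C x) \<bullet> closest_point C x = 0"
    "y \<in> C \<Longrightarrow> (x - closest_point C x) \<bullet> y \<le> 0"
proof -
  note C' = closed_convex_coneD[OF C]
  let ?p = "closest_point C x"
  show p: "?p \<in> C" by (rule closest_point_in_set[OF C'(1,3)])
  have le: "(x - ?p) \<bullet> (z - ?p) \<le> 0" if "z \<in> C" for z
    by (rule closest_point_dot[OF C'(2,1) that])
  \<comment> \<open>The variational inequality is tested at twice the projection and then at the
    origin; together they force orthogonality.\<close>
  have "(x - ?p) \<bullet> ?p \<le> 0" using le[OF C'(5)[OF p p]] by simp
  with le[OF C'(4)] show 0: "(x - ?p) \<bullet> ?p = 0" by simp
  show "(x - ?p) \<bullet> y \<le> 0" if "y \<in> C"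
    using le[OF that] 0 by (simp add: inner_diff_right)
qed

text \<open>Converse of \<open>closest_point_cone\<close>: expanding |x - z|^2 around
  \<open>p\<close>, the cross term is nonnegative, so \<open>p\<close> minimizes the
  distance.\<close>

lemma closest_point_cone_eqI:
  fixes x :: "'a::euclidean_space"
  assumes C: "closed_convex_cone C" and p: "p \<in> C" "(x - p) \<bullet> p = 0"
    and le: "\<And>y. y \<in> C \<Longrightarrow> (x - p) \<bullet> y \<le> 0"
  shows "closest_point C x = p"
proof (rule closest_point_unique[symmetric])
  show "convex C" "closed C" "p \<in> C" using closed_convex_coneD[OF C] p by auto
  show "\<forall>z\<in>C. dist x p \<le> dist x z"
  proof
    fix z assume z: "z \<in> C"
    have "0 \<le> (x - p) \<bullet> (p - z)"
      using p le[OF z] by (simp add: inner_diff_right)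
    then have "(norm (x - p))\<^sup>2 \<le> (norm (x - p))\<^sup>2 + (norm (p - z))\<^sup>2 + 2 * ((x - p) \<bullet> (p - z))"
      by simp
    also have "\<dots> = (norm (x - z))\<^sup>2"
      by (simp add: power2_norm_eq_inner inner_diff_left inner_diff_right inner_commute)
    finally show "dist x p \<le> dist x z"
      unfolding dist_norm by (rule power2_le_imp_le) simp
  qed
qed

lemma norm_closest_point_cone_le:
  fixes x :: "'a::euclidean_space"
  assumes "closed_convex_cone C"
  shows "norm (closest_point C x) \<le> norm x"
proof -
  let ?p = "closest_point C x"
  have "norm ?p * norm ?p = x \<bullet> ?p"
    using closest_point_cone(2)[OF assms, of x]
    by (simp add: inner_diff_left power2_norm_eq_inner flip: power2_eq_square)
  also have "\<dots> \<le> norm x * norm ?p" by (rule norm_cauchy_schwarz)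
  finally show ?thesis
    by (cases "norm ?p = 0") (auto simp: mult_le_cancel_right)
qed

lemma borel_measurable_closest_point:
  assumes "closed_convex_cone C"
  shows "closest_point C \<in> borel_measurable borel"
  using closed_convex_coneD[OF assms]
  by (intro borel_measurable_continuous_onI continuous_on_closest_point)

section \<open>The polar cone and the Moreau decomposition\<close>

lemma closed_convex_cone_polar_cone: "closed_convex_cone (polar_cone C)"
proof -
  have "polar_cone C = (\<Inter>x\<in>C. {u. x \<bullet> u \<le> 0})"
    by (auto simp: polar_cone_def inner_commute)
  then have "closed (polar_cone C)"
    by (auto intro: closed_halfspace_le)
  moreover have "0 \<in> polar_cone C" by (simp add: polar_cone_def)
  moreover have "\<tau> *\<^sub>R (x + y) \<in> polar_cone C" if "\<tau> > 0" "x \<in> polar_cone C" "y \<in> polar_cone C" for \<tau> x y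
    using that by (auto simp: polar_cone_def inner_add_left mult_le_0_iff intro!: add_nonpos_nonpos)
  ultimately show ?thesis
    by (auto simp: closed_convex_cone_def)
qed

text \<open>Moreau decomposition. The conditions characterizing the projection are symmetric in
  \<open>C\<close> and its polar: what remains of \<open>x\<close> after subtracting the candidate
  is a point of \<open>C\<close>, which pairs nonpositively with the polar cone.\<close>

lemma closest_point_polar_cone:
  fixes x :: "'a::euclidean_space"
  assumes C: "closed_convex_cone C"
  shows "closest_point (polar_cone C) x = x - closest_point C x"
proof (rule closest_point_cone_eqI[OF closed_convex_cone_polar_cone])
  show "x - closest_point C x \<in> polar_cone C"
    using closest_point_cone(3)[OF C] by (simp add: polar_cone_def)
  show "(x - (x - closest_point C x)) \<bullet> (x - closest_point C x) = 0"
    using closest_point_cone(2)[OF C, of x] by (simp add: inner_commute)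
  show "(x - (x - closest_point C x)) \<bullet> y \<le> 0" if "y \<in> polar_cone C" for y
    using that closest_point_cone(1)[OF C, of x] by (auto simp: polar_cone_def inner_commute)
qed

section \<open>Faces of polyhedral cones described by their tight constraints\<close>

lemma polyhedral_coneE:
  assumes "polyhedral_cone P"
  obtains U where "finite U" "P = {x. \<forall>u\<in>U. 0 \<le> u \<bullet> x}"
  using assms by (auto simp: polyhedral_cone_def)

lemma polyhedral_coneI: "finite U \<Longrightarrow> P = {x. \<forall>u\<in>U. 0 \<le> u \<bullet> x} \<Longrightarrow> polyhedral_cone P"
  by (auto simp: polyhedral_cone_def)

lemma polyhedral_cone_imp_closed_convex_cone:
  assumes "polyhedral_cone P"
  shows "closed_convex_cone P"
proof -
  obtain U where U: "P = (\<Inter>u\<in>U. {x. u \<bullet> x \<ge> 0})"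
    using assms by (auto simp: polyhedral_cone_def)
  have "closed P"
    unfolding U by (auto intro: closed_halfspace_ge)
  moreover have "0 \<in> (\<Inter>u\<in>U. {x. u \<bullet> x \<ge> 0})" by simp
  then have "P \<noteq> {}" using U by blast
  ultimately show ?thesis
    unfolding closed_convex_cone_def by (auto simp: U inner_add_right)
qed

text \<open>The tight constraints at \<open>p\<close> label the face having \<open>p\<close> in its
  relative interior. Labels range over the subsets of a finite set, so that faces need not be
  enumerated.\<close>

definition active :: "'a::euclidean_space set \<Rightarrow> 'a \<Rightarrow> 'a set" where
  "active U p = {u \<in> U. u \<bullet> p = 0}"

text \<open>For \<open>I = active U p\<close> with \<open>p\<close> in the cone, this is the linear
  hull of the face labelled by \<open>I\<close>.\<close>

definition annihilator :: "'a::euclidean_space set \<Rightarrow> 'a set" where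
  "annihilator I = {y. \<forall>u\<in>I. u \<bullet> y = 0}"

lemma subspace_annihilator: "subspace (annihilator I)"
  by (auto simp: annihilator_def subspace_def inner_add_right)

lemma in_annihilator_active: "p \<in> annihilator (active U p)"
  by (simp add: annihilator_def active_def)

lemma active_scaleR: "a > 0 \<Longrightarrow> active U (a *\<^sub>R p) = active U p"
  by (auto simp: active_def)

text \<open>The constraints that are not tight at \<open>p\<close> are strict there and finite in
  number, so they persist on a ball; the tight ones hold with equality on the annihilator.\<close>

lemma polyhedral_cone_active_ball:
  fixes p :: "'a::euclidean_space"
  assumes U: "finite U" and P: "P = {x. \<forall>u\<in>U. 0 \<le> u \<bullet> x}" and p: "p \<in> P"
  obtains r where "r > 0" "ball p r \<inter> annihilator (active U p) \<subseteq> P"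
proof -
  let ?O = "\<Inter>u\<in>U - active U p. {x. u \<bullet> x > 0}"
  have "open ?O" using U by (intro open_INT) (auto intro: open_halfspace_gt)
  moreover have "p \<in> ?O" using p P by (auto simp: active_def less_le)
  ultimately obtain r where r: "r > 0" "ball p r \<subseteq> ?O" by (meson open_contains_ball)
  have "ball p r \<inter> annihilator (active U p) \<subseteq> P"
  proof
    fix x assume x: "x \<in> ball p r \<inter> annihilator (active U p)"
    have "0 \<le> u \<bullet> x" if "u \<in> U" for u
      using x r that by (cases "u \<in> active U p") (auto simp: annihilator_def less_imp_le subset_iff)
    then show "x \<in> P" by (simp add: P)
  qed
  with r(1) show thesis by (rule that)
qed

text \<open>Being able to move both ways along \<open>w\<close> is what turns inequalities valid on
  the cone into equalities along the annihilator.\<close>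

lemma polyhedral_cone_active_segment:
  fixes p w :: "'a::euclidean_space"
  assumes U: "finite U" and P: "P = {x. \<forall>u\<in>U. 0 \<le> u \<bullet> x}" and p: "p \<in> P"
    and w: "w \<in> annihilator (active U p)"
  obtains e where "e > 0" "p + e *\<^sub>R w \<in> P" "p - e *\<^sub>R w \<in> P"
proof -
  obtain r where r: "r > 0" "ball p r \<inter> annihilator (active U p) \<subseteq> P"
    by (rule polyhedral_cone_active_ball[OF U P p])
  \<comment> \<open>The added 1 covers \<open>w = 0\<close>; the half makes the step end strictly
    inside the ball.\<close>
  define e where "e = r / 2 / (norm w + 1)"
  have e: "e > 0" using r by (simp add: e_def add_nonneg_pos)
  have "e * norm w < r"
  proof -
    have "e * norm w \<le> e * (norm w + 1)" using e by simp
    also have "\<dots> = r / 2" 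
      unfolding e_def by (rule nonzero_eq_divide_eq[THEN iffD1, OF _ refl]) (use norm_ge_zero[of w] in linarith)
    finally show ?thesis using r by simp
  qed
  then have "p + e *\<^sub>R w \<in> ball p r" "p - e *\<^sub>R w \<in> ball p r"
    using e by (simp_all add: dist_norm)
  moreover have "p + e *\<^sub>R w \<in> annihilator (active U p)" "p - e *\<^sub>R w \<in> annihilator (active U p)"
    using w in_annihilator_active[of p U] subspace_annihilator[of "active U p"]
    by (auto intro: subspace_add subspace_diff subspace_scale)
  ultimately show thesis using r(2) e that by blast
qed

text \<open>A functional in the polar is nonpositive on the cone and vanishes at the origin, so the
  supremum defining the face is 0.\<close>

lemma cone_face_alt:
  fixes P :: "'a::euclidean_space set"
  assumes "0 \<in> P"
  shows "cone_face F P \<longleftrightarrow> (\<exists>u\<in>polar_cone P. F = {x \<in> P. u \<bullet> x = 0})"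
proof -
  have "(SUP y\<in>P. u \<bullet> y) = 0" if "u \<in> polar_cone P" for u
    by (rule cSup_eq_maximum) (use assms that in \<open>force simp: polar_cone_def\<close>)+
  then show ?thesis by (auto simp: cone_face_def)
qed

text \<open>Minus the sum of the tight constraints exposes the face: the summands are nonnegative on
  \<open>P\<close>, so the sum vanishes only where each of them does. The ball of
  \<open>polyhedral_cone_active_ball\<close> then puts \<open>p\<close> in the relative
  interior.\<close>

lemma ex_cone_face_rel_interior:
  fixes p :: "'a::euclidean_space"
  assumes U: "finite U" and P: "P = {x. \<forall>u\<in>U. 0 \<le> u \<bullet> x}" and p: "p \<in> P"
  shows "\<exists>F. cone_face F P \<and> p \<in> rel_interior F"
proof -
  let ?I = "active U p"
  let ?u = "- (\<Sum>v\<in>?I. v)"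
  let ?F = "P \<inter> annihilator ?I"
  have zero: "0 \<in> P" by (simp add: P)
  have fI: "finite ?I" using U by (simp add: active_def)
  have nonneg: "0 \<le> v \<bullet> x" if "v \<in> ?I" "x \<in> P" for v x
    using that by (auto simp: active_def P)
  have "?u \<bullet> x = 0 \<longleftrightarrow> x \<in> annihilator ?I" if "x \<in> P" for x
    using sum_nonneg_eq_0_iff[OF fI nonneg[OF _ that]]
    by (simp add: inner_sum_left annihilator_def)
  then have F: "?F = {x \<in> P. ?u \<bullet> x = 0}" by auto
  have "?u \<in> polar_cone P"
    using nonneg by (auto simp: polar_cone_def inner_sum_left intro!: sum_nonneg)
  then have "cone_face ?F P"
    unfolding F using cone_face_alt[of P "{x \<in> P. ?u \<bullet> x = 0}"] zero by blast
  moreover have "p \<in> rel_interior ?F"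
  proof -
    obtain r where r: "r > 0" "ball p r \<inter> annihilator ?I \<subseteq> P"
      by (rule polyhedral_cone_active_ball[OF U P p])
    have "affine hull ?F \<subseteq> annihilator ?I"
      by (intro hull_minimal subspace_imp_affine subspace_annihilator) auto
    with r p in_annihilator_active[of p U] show ?thesis
      by (subst mem_rel_interior_ball) blast
  qed
  ultimately show ?thesis by blast
qed

text \<open>Both sets have the same span. A segment from a point \<open>y\<close> of the face
  through \<open>p\<close> can be prolonged beyond \<open>p\<close> inside the face, so a constraint
  that is zero at \<open>p\<close> and nonnegative at both ends vanishes at \<open>y\<close>; this
  puts the face into the annihilator.\<close>

lemma dim_cone_face_rel_interior:
  fixes p :: "'a::euclidean_space"
  assumes U: "finite U" and P: "P = {x. \<forall>u\<in>U. 0 \<le> u \<bullet> x}" and F: "cone_face F P"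
    and p: "p \<in> rel_interior F"
  shows "dim F = dim (annihilator (active U p))"
proof -
  let ?L = "annihilator (active U p)"
  have "0 \<in> P" by (simp add: P)
  then obtain w where w: "w \<in> polar_cone P" and Fw: "F = {x \<in> P. w \<bullet> x = 0}"
    using F cone_face_alt by blast
  have pF: "p \<in> F" using p rel_interior_subset by blast
  then have pP: "p \<in> P" and wp: "w \<bullet> p = 0" by (auto simp: Fw)
  have "convex F"
    by (auto simp: Fw P convex_def inner_add_right)
  then have ext: "\<exists>m>1. (1 - m) *\<^sub>R y + m *\<^sub>R p \<in> F" if "y \<in> F" for y
    using convex_rel_interior_if[OF _ p] that hull_inc[of y F affine] by blast
  have "F \<subseteq> ?L"
  proof
    fix y assume y: "y \<in> F"
    obtain m where m: "m > 1" "(1 - m) *\<^sub>R y + m *\<^sub>R p \<in> F" using ext[OF y] by blast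
    have "v \<bullet> y = 0" if "v \<in> active U p" for v
    proof (rule antisym)
      have "0 \<le> v \<bullet> ((1 - m) *\<^sub>R y + m *\<^sub>R p)" using that m by (auto simp: active_def Fw P)
      then have "0 \<le> (1 - m) * (v \<bullet> y)" using that by (simp add: inner_add_right active_def)
      then show "v \<bullet> y \<le> 0" using m by (simp add: zero_le_mult_iff)
      show "0 \<le> v \<bullet> y" using that y by (auto simp: active_def Fw P)
    qed
    then show "y \<in> ?L" by (simp add: annihilator_def)
  qed
  then have "span F \<subseteq> ?L" by (intro span_minimal subspace_annihilator)
  moreover have "?L \<subseteq> span F"
  proof
    fix l assume l: "l \<in> ?L"
    obtain e where e: "e > 0" "p + e *\<^sub>R l \<in> P" "p - e *\<^sub>R l \<in> P"
      by (rule polyhedral_cone_active_segment[OF U P pP l])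
    \<comment> \<open>The exposing functional is nonpositive at both ends of the segment and zero at
      its midpoint \<open>p\<close>, hence constant along it; the segment stays in the face.\<close>
    have "w \<bullet> (p + e *\<^sub>R l) \<le> 0" "w \<bullet> (p - e *\<^sub>R l) \<le> 0"
      using w e by (auto simp: polar_cone_def)
    then have "e * (w \<bullet> l) = 0" using wp by (simp add: inner_add_right inner_diff_right)
    then have "p + e *\<^sub>R l \<in> F" using e wp by (simp add: Fw inner_add_right)
    then have "(p + e *\<^sub>R l) - p \<in> span F" using pF by (intro span_diff span_base)
    then show "l \<in> span F" using e span_mul[of "e *\<^sub>R l" F "1 / e"] by simp
  qed
  ultimately have "span F = ?L" by blast
  then show ?thesis using dim_span[of F] by simp
qed

text \<open>Replaces the quantifier over faces in the definition of the intrinsic volumes by a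
  condition on tight constraints, from which measurability and finite additivity can be read
  off.\<close>

lemma ex_cone_face_dim_iff:
  fixes p :: "'a::euclidean_space"
  assumes U: "finite U" and P: "P = {x. \<forall>u\<in>U. 0 \<le> u \<bullet> x}" and p: "p \<in> P"
  shows "(\<exists>F. cone_face F P \<and> dim F = k \<and> p \<in> rel_interior F) \<longleftrightarrow> dim (annihilator (active U p)) = k"
  using dim_cone_face_rel_interior[OF U P] ex_cone_face_rel_interior[OF assms] by metis

section \<open>Behaviour of the projection under scaling of its two components\<close>

text \<open>The conditions characterizing the projection survive multiplying the projection and the
  residual by separate nonnegative factors.\<close>

lemma closest_point_cone_scale:
  fixes x :: "'a::euclidean_space"
  assumes C: "closed_convex_cone C" and "a \<ge> 0" "b \<ge> 0"
  shows "closest_point C (a *\<^sub>R closest_point C x + b *\<^sub>R (x - closest_point C x)) = a *\<^sub>R closest_point C x"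
  using closest_point_cone(1,2)[OF C, of x] closest_point_cone(3)[OF C, of _ x] assms closed_convex_coneD(6)[OF C]
  by (intro closest_point_cone_eqI) (auto simp: mult_nonneg_nonpos)

text \<open>The residual pairs to zero with the projection and nonpositively with the cone, while
  the cone contains a segment in direction \<open>w\<close> centred at the projection.\<close>

lemma closest_point_residual_orthogonal:
  fixes x w :: "'a::euclidean_space"
  assumes U: "finite U" and P: "P = {x. \<forall>u\<in>U. 0 \<le> u \<bullet> x}"
    and w: "w \<in> annihilator (active U (closest_point P x))"
  shows "(x - closest_point P x) \<bullet> w = 0"
proof -
  have C: "closed_convex_cone P"
    using polyhedral_coneI[OF U P] by (rule polyhedral_cone_imp_closed_convex_cone)
  let ?p = "closest_point P x"
  obtain e where e: "e > 0" "?p + e *\<^sub>R w \<in> P" "?p - e *\<^sub>R w \<in> P"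
    by (rule polyhedral_cone_active_segment[OF U P closest_point_cone(1)[OF C] w])
  have "(x - ?p) \<bullet> (?p + e *\<^sub>R w) \<le> 0" "(x - ?p) \<bullet> (?p - e *\<^sub>R w) \<le> 0"
    using closest_point_cone(3)[OF C] e by auto
  then show ?thesis
    using e closest_point_cone(2)[OF C, of x]
    by (auto simp: inner_add_right inner_diff_right mult_le_0_iff zero_le_mult_iff)
qed

section \<open>The conic Hausdorff metric\<close>

lemma cosine_bounds:
  fixes x y :: "'a::euclidean_space"
  shows "- 1 \<le> x \<bullet> y / (norm x * norm y)" "x \<bullet> y / (norm x * norm y) \<le> 1"
proof -
  have "\<bar>x \<bullet> y / (norm x * norm y)\<bar> \<le> 1"
  proof (cases "x = 0 \<or> y = 0")
    case False
    then have "norm x * norm y > 0" by simp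
    then show ?thesis
      using Cauchy_Schwarz_ineq2[of x y] by (simp add: abs_mult divide_le_eq)
  qed auto
  then show "- 1 \<le> x \<bullet> y / (norm x * norm y)" "x \<bullet> y / (norm x * norm y) \<le> 1" by linarith+
qed

lemma angular_dist_le_pi: "angular_dist x y \<le> pi"
  unfolding angular_dist_def using arccos_ubound[OF cosine_bounds[of x y]] pi_ge_zero by auto

lemma angular_dist_self [simp]: "angular_dist x x = 0"
  by (simp add: angular_dist_def power2_norm_eq_inner flip: power2_eq_square)

lemma angular_expansion_mono: "\<alpha> \<le> \<beta> \<Longrightarrow> angular_expansion C \<alpha> \<subseteq> angular_expansion C \<beta>"
  by (force simp: angular_expansion_def)

lemma conic_hausdorff_dist_lessD:
  assumes "conic_hausdorff_dist C1 C2 < \<alpha>" "C1 \<noteq> {}" "C2 \<noteq> {}"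
  shows "C2 \<subseteq> angular_expansion C1 \<alpha>" "C1 \<subseteq> angular_expansion C2 \<alpha>"
proof -
  let ?X = "{\<alpha>. \<alpha> \<ge> 0 \<and> C2 \<subseteq> angular_expansion C1 \<alpha> \<and> C1 \<subseteq> angular_expansion C2 \<alpha>}"
  \<comment> \<open>The angle pi is always admissible between nonempty sets, so the infimum is taken
    over a nonempty set.\<close>
  have "pi \<in> ?X"
    using assms angular_dist_le_pi by (auto simp: angular_expansion_def)
  then have "?X \<noteq> {}" by blast
  then obtain \<beta> where "\<beta> \<in> ?X" "\<beta> < \<alpha>"
    using cInf_lessD[of ?X \<alpha>] assms by (auto simp: conic_hausdorff_dist_def)
  then show "C2 \<subseteq> angular_expansion C1 \<alpha>" "C1 \<subseteq> angular_expansion C2 \<alpha>"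
    using angular_expansion_mono[of \<beta> \<alpha> C1] angular_expansion_mono[of \<beta> \<alpha> C2] by auto
qed

lemma conic_hausdorff_dist_le:
  assumes "\<alpha> \<ge> 0" "C2 \<subseteq> angular_expansion C1 \<alpha>" "C1 \<subseteq> angular_expansion C2 \<alpha>"
  shows "0 \<le> conic_hausdorff_dist C1 C2" "conic_hausdorff_dist C1 C2 \<le> \<alpha>"
proof -
  let ?X = "{\<alpha>. \<alpha> \<ge> 0 \<and> C2 \<subseteq> angular_expansion C1 \<alpha> \<and> C1 \<subseteq> angular_expansion C2 \<alpha>}"
  have "\<alpha> \<in> ?X" using assms by simp
  moreover have "bdd_below ?X" by (auto intro!: bdd_belowI[of _ 0])
  ultimately show "0 \<le> conic_hausdorff_dist C1 C2" "conic_hausdorff_dist C1 C2 \<le> \<alpha>"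
    unfolding conic_hausdorff_dist_def by (auto intro!: cInf_greatest cInf_lower)
qed

text \<open>A chord is no longer than its arc: the left side is the squared chord of a unit arc of
  angle \<open>\<alpha>\<close>.\<close>

lemma one_minus_cos_le: "2 * (1 - cos \<alpha>) \<le> (\<alpha>::real)\<^sup>2"
proof -
  have "(sin (\<alpha> / 2))\<^sup>2 \<le> (\<alpha> / 2)\<^sup>2"
    using abs_sin_x_le_abs_x[of "\<alpha> / 2"] by (simp only: abs_le_square_iff)
  then show ?thesis
    using cos_double_sin[of "\<alpha> / 2"] by (simp add: power_divide)
qed

text \<open>A cone contains the whole ray through a point at small angle to \<open>x\<close>; the
  point of that ray with the length of \<open>x\<close> is a chord away.\<close>

lemma angular_expansion_norm_diff:
  fixes x :: "'a::euclidean_space"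
  assumes C: "closed_convex_cone C" and x: "x \<in> angular_expansion C \<alpha>" and \<alpha>: "0 \<le> \<alpha>" "\<alpha> < pi / 2"
  obtains y where "y \<in> C" "norm (x - y) \<le> \<alpha> * norm x"
proof (cases "x = 0")
  case True
  then show thesis using that[of 0] closed_convex_coneD(4)[OF C] by simp
next
  case False
  obtain y where y: "y \<in> C" "angular_dist x y \<le> \<alpha>"
    using x by (auto simp: angular_expansion_def)
  \<comment> \<open>The origin is at angle pi/2 from every nonzero vector, which exceeds
    \<open>\<alpha>\<close>.\<close>
  with False \<alpha> have y0: "y \<noteq> 0" by (auto simp: angular_dist_def)
  define c where "c = x \<bullet> y / (norm x * norm y)"
  have c: "- 1 \<le> c" "c \<le> 1" unfolding c_def by (rule cosine_bounds)+
  have "arccos c \<le> \<alpha>" using y False y0 by (simp add: angular_dist_def c_def)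
  then have "cos \<alpha> \<le> cos (arccos c)"
    using \<alpha> c by (intro cos_monotone_0_pi_le) (auto intro: arccos_lbound)
  then have "cos \<alpha> \<le> c" using c by simp
  let ?y = "(norm x / norm y) *\<^sub>R y"
  have sq: "(norm (x - z))\<^sup>2 = (norm x)\<^sup>2 + (norm z)\<^sup>2 - 2 * (x \<bullet> z)" for z
    by (simp add: power2_norm_eq_inner inner_diff_left inner_diff_right inner_commute)
  have ny: "norm ?y = norm x" using y0 by simp
  have "(norm (x - ?y))\<^sup>2 = (norm x)\<^sup>2 + (norm x)\<^sup>2 - 2 * (x \<bullet> ?y)"
    using sq[of ?y] unfolding ny .
  also have "x \<bullet> ?y = (norm x)\<^sup>2 * c"
    using False y0 by (simp add: c_def field_simps power2_eq_square)
  also have "(norm x)\<^sup>2 + (norm x)\<^sup>2 - 2 * ((norm x)\<^sup>2 * c) = (norm x)\<^sup>2 * (2 * (1 - c))"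
    by (simp add: algebra_simps)
  also have "\<dots> \<le> (norm x)\<^sup>2 * \<alpha>\<^sup>2"
    using \<open>cos \<alpha> \<le> c\<close> one_minus_cos_le[of \<alpha>] by (intro mult_left_mono) auto
  also have "\<dots> = (\<alpha> * norm x)\<^sup>2" by (simp add: power_mult_distrib)
  finally have "norm (x - ?y) \<le> \<alpha> * norm x"
    by (rule power2_le_imp_le) (simp add: \<alpha>)
  then show thesis using y closed_convex_coneD(6)[OF C, of "norm x / norm y" y] that by simp
qed

text \<open>With projections p and q onto \<open>C\<close> and \<open>D\<close>, |q - p|^2 is the
  sum of (x - p).(q - p) and (x - q).(p - q). In each term the foreign projection is replaced by a
  nearby point of the home cone, where the variational inequality gives a nonpositive value; the
  replacement costs at most \<open>\<alpha>\<close> times |x|^2.\<close>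

lemma closest_point_cone_diff:
  fixes x :: "'a::euclidean_space"
  assumes C: "closed_convex_cone C" and D: "closed_convex_cone D"
    and CD: "C \<subseteq> angular_expansion D \<alpha>" "D \<subseteq> angular_expansion C \<alpha>" and \<alpha>: "0 \<le> \<alpha>" "\<alpha> < pi / 2"
  shows "(norm (closest_point D x - closest_point C x))\<^sup>2 \<le> 2 * \<alpha> * (norm x)\<^sup>2"
proof -
  have key: "(x - closest_point C x) \<bullet> (closest_point D x - closest_point C x) \<le> \<alpha> * (norm x)\<^sup>2"
    if C: "closed_convex_cone C" and D: "closed_convex_cone D" and CD: "D \<subseteq> angular_expansion C \<alpha>"
    for C D :: "'a set"
  proof -
    let ?p = "closest_point C x" and ?q = "closest_point D x"
    have "?q \<in> angular_expansion C \<alpha>" using CD closest_point_cone(1)[OF D] by blast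
    then obtain y where y: "y \<in> C" "norm (?q - y) \<le> \<alpha> * norm ?q"
      by (rule angular_expansion_norm_diff[OF C _ \<alpha>])
    have n: "norm (x - ?p) \<le> norm x"
      using norm_closest_point_cone_le[OF closed_convex_cone_polar_cone, of C x] closest_point_polar_cone[OF C, of x]
      by simp
    have "(x - ?p) \<bullet> (?q - ?p) = (x - ?p) \<bullet> (?q - y) + (x - ?p) \<bullet> y - (x - ?p) \<bullet> ?p"
      by (simp add: inner_diff_right)
    also have "\<dots> \<le> (x - ?p) \<bullet> (?q - y)"
      using closest_point_cone(2)[OF C, of x] closest_point_cone(3)[OF C y(1), of x] by linarith
    also have "\<dots> \<le> norm (x - ?p) * norm (?q - y)" by (rule norm_cauchy_schwarz)
    also have "\<dots> \<le> norm x * (\<alpha> * norm x)"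
      using n order_trans[OF y(2) mult_left_mono[OF norm_closest_point_cone_le[OF D, of x] \<alpha>(1)]]
      by (intro mult_mono) auto
    finally show ?thesis by (simp add: power2_eq_square mult_ac)
  qed
  have "(norm (closest_point D x - closest_point C x))\<^sup>2
      = (x - closest_point C x) \<bullet> (closest_point D x - closest_point C x)
        + (x - closest_point D x) \<bullet> (closest_point C x - closest_point D x)"
    by (simp add: power2_norm_eq_inner inner_diff_left inner_diff_right inner_commute)
  then show ?thesis using key[OF C D CD(2)] key[OF D C CD(1)] by simp
qed

lemma closest_point_conic_hausdorff_tendsto:
  fixes x :: "'a::euclidean_space"
  assumes C: "closed_convex_cone C" and P: "\<And>i. closed_convex_cone (P i)"
    and lim: "(\<lambda>i. conic_hausdorff_dist (P i) C) \<longlonglongrightarrow> 0"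
  shows "(\<lambda>i. closest_point (P i) x) \<longlonglongrightarrow> closest_point C x"
proof -
  \<comment> \<open>The absolute value makes \<open>\<alpha> i\<close> nonnegative, and the
    vanishing summand makes it strictly larger than the distance, so that it is an admissible
    angle.\<close>
  define \<alpha> where "\<alpha> i = \<bar>conic_hausdorff_dist (P i) C\<bar> + 1 / real (Suc i)" for i
  have "\<alpha> \<longlonglongrightarrow> \<bar>0\<bar> + 0"
    unfolding \<alpha>_def by (intro tendsto_intros lim LIMSEQ_Suc[OF lim_1_over_n])
  then have \<alpha>: "\<alpha> \<longlonglongrightarrow> 0" by (simp only: abs_zero add_0)
  have \<alpha>_gt: "conic_hausdorff_dist (P i) C < \<alpha> i" "0 \<le> \<alpha> i" for i
  proof -
    have "0 < 1 / real (Suc i)" by simp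
    then show "conic_hausdorff_dist (P i) C < \<alpha> i" "0 \<le> \<alpha> i" unfolding \<alpha>_def by linarith+
  qed
  have "\<forall>\<^sub>F i in sequentially. (norm (closest_point (P i) x - closest_point C x))\<^sup>2 \<le> 2 * \<alpha> i * (norm x)\<^sup>2"
    using order_tendstoD(2)[OF \<alpha> pi_half_gt_zero]
  proof eventually_elim
    case (elim i)
    note sub = conic_hausdorff_dist_lessD[OF \<alpha>_gt(1) closed_convex_coneD(3)[OF P] closed_convex_coneD(3)[OF C], of i]
    show ?case by (rule closest_point_cone_diff[OF C P sub \<alpha>_gt(2) elim])
  qed
  moreover have "(\<lambda>i. 2 * \<alpha> i * (norm x)\<^sup>2) \<longlonglongrightarrow> 0"
    by (rule tendsto_mult_left_zero[OF tendsto_mult_right_zero[OF \<alpha>]])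
  ultimately have "(\<lambda>i. (norm (closest_point (P i) x - closest_point C x))\<^sup>2) \<longlonglongrightarrow> 0"
    by (rule tendsto_sandwich[OF always_eventually[OF allI[OF zero_le_power2]] _ tendsto_const])
  then have "(\<lambda>i. sqrt ((norm (closest_point (P i) x - closest_point C x))\<^sup>2)) \<longlonglongrightarrow> sqrt 0"
    by (rule tendsto_real_sqrt)
  then have "(\<lambda>i. norm (closest_point (P i) x - closest_point C x)) \<longlonglongrightarrow> 0"
    by simp
  then show ?thesis
    by (rule LIM_zero_cancel[OF tendsto_norm_zero_cancel])
qed

section \<open>Density of polyhedral cones in the conic Hausdorff metric\<close>

text \<open>Outer approximation. Each unit vector at distance at least sin \<open>\<epsilon>\<close>
  from \<open>C\<close> is strictly separated from \<open>C\<close> by its own residual, an element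
  of the polar; by compactness finitely many such halfspaces exclude all of these vectors.\<close>

lemma ex_polyhedral_cone_near:
  fixes C :: "'a::euclidean_space set"
  assumes C: "closed_convex_cone C" and \<epsilon>: "0 < \<epsilon>" "\<epsilon> \<le> 1"
  shows "\<exists>P. polyhedral_cone P \<and> 0 \<le> conic_hausdorff_dist P C \<and> conic_hausdorff_dist P C \<le> \<epsilon>"
proof -
  have \<epsilon>': "\<epsilon> < pi / 2" using \<epsilon> pi_gt3 by linarith
  have cos: "cos \<epsilon> > 0" using \<epsilon> \<epsilon>' by (intro cos_gt_zero) auto
  have sin: "sin \<epsilon> > 0" using \<epsilon> \<epsilon>' by (intro sin_gt_zero) auto
  let ?K = "{x. norm x = 1 \<and> sin \<epsilon> \<le> norm (x - closest_point C x)}"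
  let ?O = "\<lambda>u. {x. u \<bullet> x > 0}"
  have cont: "continuous_on UNIV (closest_point C)"
    using closed_convex_coneD[OF C] by (intro continuous_on_closest_point)
  have "closed ?K"
    by (intro closed_Collect_conj closed_Collect_eq closed_Collect_le continuous_intros cont)
  moreover have "bounded ?K" by (rule boundedI[of _ 1]) auto
  ultimately have "compact ?K" by (simp add: compact_eq_bounded_closed)
  moreover have "open (?O u)" for u by (rule open_halfspace_gt)
  moreover have "?K \<subseteq> (\<Union>u\<in>polar_cone C. ?O u)"
  proof
    fix x assume x: "x \<in> ?K"
    let ?u = "x - closest_point C x"
    have "?u \<bullet> x = ?u \<bullet> ?u" using closest_point_cone(2)[OF C, of x] by (simp add: inner_diff_right)
    moreover have "?u \<noteq> 0" using x sin by auto
    ultimately have "?u \<bullet> x > 0" by simp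
    moreover have "?u \<in> polar_cone C" using closest_point_cone(3)[OF C] by (simp add: polar_cone_def)
    ultimately show "x \<in> (\<Union>u\<in>polar_cone C. ?O u)" by blast
  qed
  ultimately obtain U where U: "U \<subseteq> polar_cone C" "finite U" "?K \<subseteq> (\<Union>u\<in>U. ?O u)"
    by (rule compactE_image)
  \<comment> \<open>The sign changes because polar vectors are nonpositive on \<open>C\<close>,
    whereas polyhedral cones are written with nonnegative constraints.\<close>
  define P where "P = {x. \<forall>u\<in>uminus ` U. 0 \<le> u \<bullet> x}"
  have P: "polyhedral_cone P" using U by (intro polyhedral_coneI[OF _ P_def]) auto
  have "C \<subseteq> P" using U by (auto simp: P_def polar_cone_def subset_iff)
  then have CP: "C \<subseteq> angular_expansion P \<epsilon>"
    using \<epsilon> by (force simp: angular_expansion_def)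
  have PC: "P \<subseteq> angular_expansion C \<epsilon>"
  proof
    fix x assume x: "x \<in> P"
    show "x \<in> angular_expansion C \<epsilon>"
    proof (cases "x = 0")
      case True
      then show ?thesis using closed_convex_coneD(4)[OF C] \<epsilon> by (force simp: angular_expansion_def)
    next
      case False
      let ?x = "(1 / norm x) *\<^sub>R x"
      let ?y = "closest_point C ?x"
      have "?x \<in> P" using x by (auto simp: P_def divide_nonpos_nonneg)
      then have "?x \<notin> ?K" using U(3) by (fastforce simp: P_def)
      then have "norm (?x - ?y) < sin \<epsilon>" using False by simp
      \<comment> \<open>By Pythagoras, a unit vector closer than sin \<open>\<epsilon>\<close> to
        its projection has a projection of norm at least cos \<open>\<epsilon>\<close>.\<close>
      then have "(norm (?x - ?y))\<^sup>2 \<le> (sin \<epsilon>)\<^sup>2" by (intro power_mono) auto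
      moreover have "(norm ((?x - ?y) + ?y))\<^sup>2 = (norm (?x - ?y))\<^sup>2 + (norm ?y)\<^sup>2"
        using closest_point_cone(2)[OF C, of ?x] by (intro norm_add_Pythagorean) (simp add: orthogonal_def)
      moreover have "(norm ((?x - ?y) + ?y))\<^sup>2 = 1" using False by simp
      ultimately have "(cos \<epsilon>)\<^sup>2 \<le> (norm ?y)\<^sup>2"
        using sin_cos_squared_add[of \<epsilon>] by linarith
      then have ny: "cos \<epsilon> \<le> norm ?y" by (rule power2_le_imp_le) simp
      then have y0: "?y \<noteq> 0" using cos by auto
      have y1: "norm ?y \<le> 1" using norm_closest_point_cone_le[OF C, of ?x] False by simp
      \<comment> \<open>So the cosine of the angle between \<open>x\<close> and its projection is
        the norm of that projection.\<close>
      have "?x \<bullet> ?y = (norm ?y)\<^sup>2"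
        using closest_point_cone(2)[OF C, of ?x] by (simp add: inner_diff_left power2_norm_eq_inner)
      then have "x \<bullet> ?y = norm x * (norm ?y)\<^sup>2" using False by (simp add: field_simps)
      then have "angular_dist x ?y = arccos (norm ?y)"
        using False y0 by (simp add: angular_dist_def power2_eq_square)
      also have "\<dots> \<le> arccos (cos \<epsilon>)"
        using ny y1 by (intro arccos_le_arccos) auto
      also have "\<dots> = \<epsilon>" using \<epsilon> \<epsilon>' by (intro arccos_cos) auto
      finally show ?thesis
        using closest_point_cone(1)[OF C] by (auto simp: angular_expansion_def)
    qed
  qed
  show ?thesis
    using P conic_hausdorff_dist_le[OF _ CP PC] \<epsilon> by auto
qed

lemma ex_polyhedral_cones_tendsto:
  fixes C :: "'a::euclidean_space set"
  assumes C: "closed_convex_cone C"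
  obtains P where "\<And>i::nat. polyhedral_cone (P i)" "(\<lambda>i. conic_hausdorff_dist (P i) C) \<longlonglongrightarrow> 0"
proof -
  have "\<exists>P. polyhedral_cone P \<and> 0 \<le> conic_hausdorff_dist P C \<and> conic_hausdorff_dist P C \<le> 1 / real (Suc i)" for i
    by (rule ex_polyhedral_cone_near[OF C]) auto
  then obtain P where P: "\<And>i. polyhedral_cone (P i)" "\<And>i. 0 \<le> conic_hausdorff_dist (P i) C"
    "\<And>i. conic_hausdorff_dist (P i) C \<le> 1 / real (Suc i)"
    by metis
  have "(\<lambda>i. conic_hausdorff_dist (P i) C) \<longlonglongrightarrow> 0"
    by (rule tendsto_sandwich[of "\<lambda>_. 0" _ _ "\<lambda>i. 1 / real (Suc i)"])
       (use P LIMSEQ_Suc[OF lim_1_over_n] in auto)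
  with P(1) show thesis by (rule that)
qed

section \<open>Laplace transforms\<close>

text \<open>Dividing by \<open>X - c\<close> preserves the convergence of values away from \<open>c\<close>, and the coefficients are recovered
  from those of the quotient, so that the degree can be decreased.\<close>

lemma poly_coeff_convergent:
  fixes A :: "real set" and l :: "real \<Rightarrow> real"
  assumes "infinite A"
  shows "\<exists>w. \<forall>p :: nat \<Rightarrow> real poly. (\<forall>i. degree (p i) \<le> d) \<longrightarrow>
           (\<forall>a\<in>A. (\<lambda>i. poly (p i) a) \<longlonglongrightarrow> l a) \<longrightarrow> (\<forall>k. (\<lambda>i. coeff (p i) k) \<longlonglongrightarrow> w k)"
  using assms
proof (induction d arbitrary: A l)
  case 0
  then obtain c where c: "c \<in> A" by (metis finite.emptyI equals0I)
  show ?case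
  proof (intro exI[of _ "\<lambda>k. if k = 0 then l c else 0"] allI impI)
    fix p :: "nat \<Rightarrow> real poly" and k
    assume deg: "\<forall>i. degree (p i) \<le> 0" and lim: "\<forall>a\<in>A. (\<lambda>i. poly (p i) a) \<longlonglongrightarrow> l a"
    have "coeff (p i) k = (if k = 0 then poly (p i) c else 0)" for i
    proof -
      obtain b where "p i = [:b:]" using deg by (metis degree_eq_zeroE le_zero_eq)
      then show ?thesis by (cases k) auto
    qed
    then show "(\<lambda>i. coeff (p i) k) \<longlonglongrightarrow> (if k = 0 then l c else 0)"
      using lim c by (cases "k = 0") auto
  qed
next
  case (Suc d)
  then obtain c where c: "c \<in> A" by (metis finite.emptyI equals0I)
  have "infinite (A - {c})" using Suc.prems by simp
  from Suc.IH[OF this, of "\<lambda>a. (l a - l c) / (a - c)"] obtain w where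
    w: "\<And>p :: nat \<Rightarrow> real poly. \<forall>i. degree (p i) \<le> d \<Longrightarrow>
           \<forall>a\<in>A - {c}. (\<lambda>i. poly (p i) a) \<longlonglongrightarrow> (l a - l c) / (a - c) \<Longrightarrow> \<forall>k. (\<lambda>i. coeff (p i) k) \<longlonglongrightarrow> w k"
    by blast
  show ?case
  proof (intro exI[of _ "\<lambda>k. case k of 0 \<Rightarrow> l c - c * w 0 | Suc j \<Rightarrow> w j - c * w (Suc j)"] allI impI)
    fix p :: "nat \<Rightarrow> real poly" and k
    assume deg: "\<forall>i. degree (p i) \<le> Suc d" and lim: "\<forall>a\<in>A. (\<lambda>i. poly (p i) a) \<longlonglongrightarrow> l a"
    let ?q = "\<lambda>i. synthetic_div (p i) c"
    have pq: "p i = [:- c, 1:] * ?q i + [:poly (p i) c:]" for i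
      by (rule synthetic_div_correct'[symmetric])
    have "poly (?q i) a = (poly (p i) a - poly (p i) c) / (a - c)" if "a \<noteq> c" for a i
    proof -
      have "poly (p i) a = (a - c) * poly (?q i) a + poly (p i) c"
        using arg_cong[OF pq, of "\<lambda>r. poly r a"] by (simp add: algebra_simps)
      then show ?thesis using that by (simp add: field_simps)
    qed
    then have "\<forall>a\<in>A - {c}. (\<lambda>i. poly (?q i) a) \<longlonglongrightarrow> (l a - l c) / (a - c)"
      using lim c by (auto intro!: tendsto_intros)
    moreover have "\<forall>i. degree (?q i) \<le> d"
      using deg by (auto simp: degree_synthetic_div le_diff_conv)
    ultimately have q: "(\<lambda>i. coeff (?q i) j) \<longlonglongrightarrow> w j" for j
      using w[of ?q] by blast
    have coeff: "coeff (p i) k = (case k of 0 \<Rightarrow> poly (p i) c - c * coeff (?q i) 0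
        | Suc j \<Rightarrow> coeff (?q i) j - c * coeff (?q i) (Suc j))" for i
      using arg_cong[OF synthetic_div_correct[of "p i" c], of "\<lambda>r. coeff r k"]
      by (cases k) (simp_all add: algebra_simps)
    show "(\<lambda>i. coeff (p i) k) \<longlonglongrightarrow> (case k of 0 \<Rightarrow> l c - c * w 0 | Suc j \<Rightarrow> w j - c * w (Suc j))"
      unfolding coeff using lim c q by (cases k) (auto intro!: tendsto_intros)
  qed
qed

text \<open>The order of quantifiers matters: one \<open>w\<close> serves every sequence with the
  given limit values. This yields independence of the approximating polyhedral cones.\<close>

lemma sum_coeff_convergent:
  fixes A :: "real set" and l :: "real \<Rightarrow> real"
  assumes "infinite A"
  shows "\<exists>w. \<forall>v :: nat \<Rightarrow> nat \<Rightarrow> real. (\<forall>a\<in>A. (\<lambda>i. \<Sum>k\<le>d. v i k * a ^ k) \<longlonglongrightarrow> l a) \<longrightarrow>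
    (\<forall>k\<le>d. (\<lambda>i. v i k) \<longlonglongrightarrow> w k)"
proof -
  obtain w where w: "\<And>p :: nat \<Rightarrow> real poly. \<forall>i. degree (p i) \<le> d \<Longrightarrow>
           \<forall>a\<in>A. (\<lambda>i. poly (p i) a) \<longlonglongrightarrow> l a \<Longrightarrow> \<forall>k. (\<lambda>i. coeff (p i) k) \<longlonglongrightarrow> w k"
    using poly_coeff_convergent[OF assms, of d l] by blast
  show ?thesis
  proof (intro exI[of _ w] allI impI)
    fix v :: "nat \<Rightarrow> nat \<Rightarrow> real" and k
    assume lim: "\<forall>a\<in>A. (\<lambda>i. \<Sum>k\<le>d. v i k * a ^ k) \<longlonglongrightarrow> l a" and k: "k \<le> d"
    let ?p = "\<lambda>i. \<Sum>k\<le>d. monom (v i k) k"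
    have "\<forall>i. degree (?p i) \<le> d"
      by (auto intro!: degree_sum_le order_trans[OF degree_monom_le])
    moreover have "\<forall>a\<in>A. (\<lambda>i. poly (?p i) a) \<longlonglongrightarrow> l a"
      using lim by (simp add: poly_sum poly_monom)
    ultimately have "(\<lambda>i. coeff (?p i) k) \<longlonglongrightarrow> w k"
      using w[of ?p] by blast
    then show "(\<lambda>i. v i k) \<longlonglongrightarrow> w k"
      using k by (simp add: coeff_sum)
  qed
qed

section \<open>First and second moments from a Laplace transform\<close>

text \<open>The right-hand side mixes transforms of chi-square laws with \<open>m k\<close> degrees
  of freedom, whose first two moments are m and m(m+2). Difference quotients of the transform at 0
  produce these values and also the integrability of \<open>X\<close> and its square.\<close>

lemma laplace_transform_moments:
  fixes X :: "'w \<Rightarrow> real" and v :: "'b \<Rightarrow> real" and m :: "'b \<Rightarrow> nat"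
  assumes M: "prob_space M" and X [measurable]: "X \<in> borel_measurable M"
    and X_nonneg: "\<And>x. 0 \<le> X x" and K: "finite K" and v1: "sum v K = 1"
    and laplace: "\<And>s. s \<ge> 0 \<Longrightarrow> (\<integral>x. exp (- s * X x) \<partial>M) = (\<Sum>k\<in>K. v k * (1 / sqrt (1 + 2 * s)) ^ m k)"
  shows "integrable M X" "(\<integral>x. X x \<partial>M) = (\<Sum>k\<in>K. v k * m k)"
    "integrable M (\<lambda>x. (X x)\<^sup>2)" "(\<integral>x. (X x)\<^sup>2 \<partial>M) = (\<Sum>k\<in>K. v k * (m k * (m k + 2)))"
proof -
  interpret prob_space M by fact
  \<comment> \<open>Difference quotient of exp(- s X) at s = 0 with step 1/(n+1) and reversed sign:
    bounded for fixed \<open>n\<close>, dominated by \<open>X\<close>, and convergent to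
    \<open>X\<close>.\<close>
  define Z where "Z n x = real (Suc n) * (1 - exp (- X x / Suc n))" for n x
  have [measurable]: "Z n \<in> borel_measurable M" for n unfolding Z_def by measurable
  have Z_nonneg: "0 \<le> Z n x" for n x using X_nonneg[of x] by (simp add: Z_def)
  have Z_le: "Z n x \<le> X x" for n x
  proof -
    have "1 - X x / Suc n \<le> exp (- X x / Suc n)" using exp_ge_add_one_self[of "- X x / Suc n"] by simp
    then have "real (Suc n) * (1 - exp (- X x / Suc n)) \<le> real (Suc n) * (X x / Suc n)"
      by (intro mult_left_mono) auto
    then show ?thesis by (simp add: Z_def)
  qed
  have Z_lim: "(\<lambda>n. Z n x) \<longlonglongrightarrow> X x" for x
  proof -
    have "((\<lambda>n. real (Suc n) * (1 - exp (- y / real (Suc n)))) \<longlongrightarrow> y) at_top" for y :: real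
      by real_asymp
    then show ?thesis by (simp add: Z_def)
  qed
  have int_exp: "integrable M (\<lambda>x. exp (- s * X x))" if "s \<ge> 0" for s
    by (rule integrable_const_bound[of _ 1]) (use that X_nonneg in auto)
  \<comment> \<open>Fatou's lemma first shows that the power of \<open>X\<close> is integrable; then
    it dominates the powers of \<open>Z\<close>, and the limits of the integrals agree.\<close>
  have main: "integrable M (\<lambda>x. X x ^ j) \<and> (\<integral>x. X x ^ j \<partial>M) = e"
    if lim: "(\<lambda>n. \<integral>x. Z n x ^ j \<partial>M) \<longlonglongrightarrow> e" and int: "\<And>n. integrable M (\<lambda>x. Z n x ^ j)" for j e
  proof -
    have Xj: "(\<lambda>n. Z n x ^ j) \<longlonglongrightarrow> X x ^ j" for x by (intro tendsto_intros Z_lim)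
    have "(\<integral>\<^sup>+x. ennreal (X x ^ j) \<partial>M) = (\<integral>\<^sup>+x. liminf (\<lambda>n. ennreal (Z n x ^ j)) \<partial>M)"
      by (intro nn_integral_cong lim_imp_Liminf[symmetric] tendsto_ennrealI Xj) simp
    also have "\<dots> \<le> liminf (\<lambda>n. \<integral>\<^sup>+x. ennreal (Z n x ^ j) \<partial>M)"
      by (rule nn_integral_liminf) measurable
    also have "(\<lambda>n. \<integral>\<^sup>+x. ennreal (Z n x ^ j) \<partial>M) = (\<lambda>n. ennreal (\<integral>x. Z n x ^ j \<partial>M))"
      by (intro ext nn_integral_eq_integral int) (simp add: Z_nonneg)
    also have "liminf (\<lambda>n. ennreal (\<integral>x. Z n x ^ j \<partial>M)) = ennreal e"
      by (intro lim_imp_Liminf tendsto_ennrealI lim) simp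
    finally have "integrable M (\<lambda>x. X x ^ j)"
      by (intro integrableI_nonneg) (auto simp: X_nonneg intro: le_less_trans)
    moreover from this have "(\<lambda>n. \<integral>x. Z n x ^ j \<partial>M) \<longlonglongrightarrow> (\<integral>x. X x ^ j \<partial>M)"
      using Xj Z_le Z_nonneg
      by (intro integral_dominated_convergence[where w="\<lambda>x. X x ^ j"]) (auto intro!: power_mono)
    ultimately show ?thesis using lim LIMSEQ_unique by blast
  qed
  have laplace': "(\<integral>x. exp (- (real i * X x / real (Suc n))) \<partial>M) =
      (\<Sum>k\<in>K. v k * (1 / sqrt (1 + 2 * (real i / real (Suc n)))) ^ m k)" for i n
    using laplace[of "real i / real (Suc n)"] by simp
  have int': "integrable M (\<lambda>x. exp (- (real i * X x / real (Suc n))))" for i n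
    using int_exp[of "real i / real (Suc n)"] by simp
  note int'' = int'[of 1, simplified] int'[of 2, simplified]
  have Z1: "(\<integral>x. Z n x ^ 1 \<partial>M) = (\<Sum>k\<in>K. v k * (real (Suc n) * (1 - (1 / sqrt (1 + 2 * (1 / real (Suc n)))) ^ m k)))"
    for n
  proof -
    have "(\<integral>x. Z n x ^ 1 \<partial>M) = real (Suc n) * (1 - (\<integral>x. exp (- (X x / real (Suc n))) \<partial>M))"
      unfolding Z_def using int''(1)[of n] by (simp add: prob_space)
    also have "\<dots> = real (Suc n) * (sum v K - (\<Sum>k\<in>K. v k * (1 / sqrt (1 + 2 * (1 / real (Suc n)))) ^ m k))"
      using laplace'[of 1 n] by (simp add: v1)
    finally show ?thesis
      by (simp add: sum_subtractf[symmetric] sum_distrib_left algebra_simps)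
  qed
  \<comment> \<open>The square is a second difference of exp(- s X), so its mean involves the
    transform only at 0, 1/(n+1) and 2/(n+1).\<close>
  have Z_sq: "Z n x ^ 2 = (real (Suc n))\<^sup>2 *
      (1 - 2 * exp (- (X x / real (Suc n))) + exp (- (2 * X x / real (Suc n))))" for n x
  proof -
    have "exp (- (2 * X x / real (Suc n))) = exp (- (X x / real (Suc n))) ^ 2"
      by (subst exp_of_nat_mult[symmetric]) simp
    then show ?thesis by (simp add: Z_def power2_eq_square algebra_simps)
  qed
  have Z2: "(\<integral>x. Z n x ^ 2 \<partial>M) = (\<Sum>k\<in>K. v k * ((real (Suc n))\<^sup>2 *
      (1 - 2 * (1 / sqrt (1 + 2 * (1 / real (Suc n)))) ^ m k + (1 / sqrt (1 + 2 * (2 / real (Suc n)))) ^ m k)))"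
    for n
  proof -
    have "(\<integral>x. Z n x ^ 2 \<partial>M) = (real (Suc n))\<^sup>2 * (1 - 2 * (\<integral>x. exp (- (X x / real (Suc n))) \<partial>M)
        + (\<integral>x. exp (- (2 * X x / real (Suc n))) \<partial>M))"
      unfolding Z_sq using int''[of n] by (simp add: prob_space)
    also have "\<dots> = (real (Suc n))\<^sup>2 * (sum v K - 2 * (\<Sum>k\<in>K. v k * (1 / sqrt (1 + 2 * (1 / real (Suc n)))) ^ m k)
         + (\<Sum>k\<in>K. v k * (1 / sqrt (1 + 2 * (2 / real (Suc n)))) ^ m k))"
      using laplace'[of 1 n] laplace'[of 2 n] by (simp add: v1)
    also have "\<dots> = (\<Sum>k\<in>K. (real (Suc n))\<^sup>2 * (v k - 2 * (v k * (1 / sqrt (1 + 2 * (1 / real (Suc n)))) ^ m k)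
         + v k * (1 / sqrt (1 + 2 * (2 / real (Suc n)))) ^ m k))"
      by (simp only: sum_distrib_left[symmetric] sum_subtractf sum.distrib)
    also have "\<dots> = (\<Sum>k\<in>K. v k * ((real (Suc n))\<^sup>2 *
      (1 - 2 * (1 / sqrt (1 + 2 * (1 / real (Suc n)))) ^ m k + (1 / sqrt (1 + 2 * (2 / real (Suc n)))) ^ m k)))"
      by (intro sum.cong refl) (simp add: algebra_simps)
    finally show ?thesis .
  qed
  have powr: "(1 / sqrt (1 + y)) ^ j = (1 + y) powr (- real j / 2)" if "y \<ge> 0" for y j
  proof -
    have "1 / sqrt (1 + y) = (1 + y) powr (- 1 / 2)"
      using that powr_minus_divide[of "1 + y" "1 / 2"] by (simp add: powr_half_sqrt)
    moreover have "((1 + y) powr (- 1 / 2)) ^ j = ((1 + y) powr (- 1 / 2)) powr real j"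
      using that by (intro powr_realpow[symmetric]) simp
    ultimately show ?thesis by (simp add: powr_powr)
  qed
  have lim1: "(\<lambda>n. real (Suc n) * (1 - (1 + 2 * (1 / real (Suc n))) powr (- c / 2))) \<longlonglongrightarrow> c" for c
    by real_asymp
  \<comment> \<open>The limit is the second derivative of (1 + 2s) powr (-c/2) at s = 0.\<close>
  have lim2: "(\<lambda>n. (real (Suc n))\<^sup>2 * (1 - 2 * (1 + 2 * (1 / real (Suc n))) powr (- c / 2)
      + (1 + 2 * (2 / real (Suc n))) powr (- c / 2))) \<longlonglongrightarrow> c * (c + 2)" for c
  proof -
    have "(\<lambda>n. (real (Suc n))\<^sup>2 * (1 - 2 * (1 + 2 * (1 / real (Suc n))) powr (- c / 2)
        + (1 + 2 * (2 / real (Suc n))) powr (- c / 2))) \<longlonglongrightarrow> - (2 * (c * (- (c / 2) - 1)))"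
      by real_asymp
    then show ?thesis by (simp add: algebra_simps)
  qed
  have int1: "integrable M (\<lambda>x. Z n x ^ 1)" for n
    unfolding Z_def using int''[of n] by simp
  have int2: "integrable M (\<lambda>x. Z n x ^ 2)" for n
    unfolding Z_sq using int''[of n] by simp
  have powr1: "(1 / sqrt (1 + 2 * (1 / real (Suc n)))) ^ j = (1 + 2 * (1 / real (Suc n))) powr (- real j / 2)"
    and powr2: "(1 / sqrt (1 + 2 * (2 / real (Suc n)))) ^ j = (1 + 2 * (2 / real (Suc n))) powr (- real j / 2)" for n j
    by (intro powr; simp)+
  have "integrable M (\<lambda>x. X x ^ 1) \<and> (\<integral>x. X x ^ 1 \<partial>M) = (\<Sum>k\<in>K. v k * m k)"
    by (rule main[OF _ int1], unfold Z1 powr1) (intro tendsto_sum tendsto_mult[OF tendsto_const] lim1)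
  then show "integrable M X" "(\<integral>x. X x \<partial>M) = (\<Sum>k\<in>K. v k * m k)" by simp_all
  have "integrable M (\<lambda>x. (X x)\<^sup>2) \<and> (\<integral>x. (X x)\<^sup>2 \<partial>M) = (\<Sum>k\<in>K. v k * (real (m k) * (real (m k) + 2)))"
    by (rule main[OF _ int2], unfold Z2 powr1 powr2) (intro tendsto_sum tendsto_mult[OF tendsto_const] lim2)
  then show "integrable M (\<lambda>x. (X x)\<^sup>2)" "(\<integral>x. (X x)\<^sup>2 \<partial>M) = (\<Sum>k\<in>K. v k * (m k * (m k + 2)))"
    by (simp_all add: algebra_simps)
qed

section \<open>The Laplace transform of the two Moreau components\<close>

text \<open>Joint transform of the squared norms of projection and residual. The axis t = 0
  describes \<open>C\<close>, and the axis s = 0 its polar.\<close>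

definition conic_laplace :: "'a::euclidean_space set \<Rightarrow> real \<Rightarrow> real \<Rightarrow> real" where
  "conic_laplace C s t =
     (\<integral>x. exp (- s * (norm (closest_point C x))\<^sup>2 - t * (norm (x - closest_point C x))\<^sup>2) \<partial>std_gaussian)"

lemma sets_active_region:
  fixes U :: "'a::euclidean_space set"
  assumes U: "finite U" and I: "I \<subseteq> U" and C: "closed_convex_cone C"
  shows "{x. active U (closest_point C x) = I} \<in> sets borel"
proof -
  note [measurable] = borel_measurable_closest_point[OF C]
  have "{x. active U (closest_point C x) = I} = {x \<in> space borel. \<forall>u\<in>U. u \<bullet> closest_point C x = 0 \<longleftrightarrow> u \<in> I}"
    using I by (auto simp: active_def)
  also have "\<dots> \<in> sets borel"
    using U by measurable
  finally show ?thesis .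
qed

text \<open>The set of points whose projection has active constraints \<open>I\<close> is invariant under independent
  scalings of the subspace \<open>annihilator I\<close> and of its orthogonal complement. Undoing the Gaussian
  tilt by such a scaling leaves only its determinant.\<close>

lemma nn_integral_active_region:
  fixes P U :: "'a::euclidean_space set" and s t :: real
  assumes U: "finite U" and P: "P = {x. \<forall>u\<in>U. 0 \<le> u \<bullet> x}" and I: "I \<subseteq> U" and s: "s \<ge> 0" and t: "t \<ge> 0"
  defines "R \<equiv> {x. active U (closest_point P x) = I}"
    and "h \<equiv> \<lambda>x. exp (- s * (norm (closest_point P x))\<^sup>2 - t * (norm (x - closest_point P x))\<^sup>2)"
  shows "(\<integral>\<^sup>+x. ennreal (h x) * indicator R x \<partial>std_gaussian) =
    ennreal ((1 / sqrt (1 + 2 * s)) ^ dim (annihilator I) * (1 / sqrt (1 + 2 * t)) ^ (DIM('a) - dim (annihilator I)))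
      * emeasure std_gaussian R"
proof -
  have C: "closed_convex_cone P"
    using polyhedral_coneI[OF U P] by (rule polyhedral_cone_imp_closed_convex_cone)
  note [measurable] = borel_measurable_closest_point[OF C]
  have [measurable]: "R \<in> sets borel"
    unfolding R_def by (rule sets_active_region[OF U I C])
  have [measurable]: "h \<in> borel_measurable borel" unfolding h_def by measurable
  let ?L = "annihilator I" and ?\<pi> = "closest_point P"
  \<comment> \<open>The factors solve a^2 (1 + 2s) = 1 and b^2 (1 + 2t) = 1, so that the Gaussian
    exponent together with the tilt at the scaled point equals the plain Gaussian exponent at the
    original one.\<close>
  define a where "a = 1 / sqrt (1 + 2 * s)"
  define b where "b = 1 / sqrt (1 + 2 * t)"
  have a: "a > 0" "a\<^sup>2 * (1 + 2 * s) = 1" using s by (auto simp: a_def power_divide)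
  have b: "b > 0" "b\<^sup>2 * (1 + 2 * t) = 1" using t by (auto simp: b_def power_divide)
  obtain T :: "'a \<Rightarrow> 'a" where T: "\<And>y z. y \<in> ?L \<Longrightarrow> (\<And>w. w \<in> ?L \<Longrightarrow> z \<bullet> w = 0) \<Longrightarrow> T (y + z) = a *\<^sub>R y + b *\<^sub>R z"
    and T_meas [measurable]: "T \<in> borel_measurable borel"
    and T_int: "\<And>f. f \<in> borel_measurable borel \<Longrightarrow>
       (\<integral>\<^sup>+x. f x \<partial>lborel) = ennreal (a ^ dim ?L * b ^ (DIM('a) - dim ?L)) * (\<integral>\<^sup>+x. f (T x) \<partial>lborel)"
    using nn_integral_lborel_scale_subspace[OF subspace_annihilator[of I] a(1) b(1)] by blast
  have pL: "?\<pi> x \<in> ?L" if "x \<in> R" for x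
    using that in_annihilator_active[of "?\<pi> x" U] by (auto simp: R_def)
  have zL: "(x - ?\<pi> x) \<bullet> w = 0" if "x \<in> R" "w \<in> ?L" for x w
    using that closest_point_residual_orthogonal[OF U P, of w x] by (auto simp: R_def)
  have scale: "c *\<^sub>R ?\<pi> x + d *\<^sub>R (x - ?\<pi> x) \<in> R" if "x \<in> R" "c > 0" "d > 0" for x c d
    using that closest_point_cone_scale[OF C, of c d x] by (simp add: R_def active_scaleR)
  have fwd: "T x = a *\<^sub>R ?\<pi> x + b *\<^sub>R (x - ?\<pi> x)" if "x \<in> R" for x
    using T[OF pL[OF that] zL[OF that]] by simp
  \<comment> \<open>\<open>T x\<close> has two orthogonal decompositions along the annihilator, one
    through its projection and one through the scaled components of \<open>x\<close>. They coincide,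
    and scaling back by 1/a and 1/b stays in \<open>R\<close>.\<close>
  have bwd: "x \<in> R" if "T x \<in> R" for x
  proof -
    obtain y z where y: "y \<in> span ?L" and z: "\<And>w. w \<in> span ?L \<Longrightarrow> orthogonal z w" and x: "x = y + z"
      using orthogonal_subspace_decomp_exists[of ?L x] by blast
    have y': "y \<in> ?L" using y subspace_annihilator span_eq_iff by blast
    have z': "z \<bullet> w = 0" if "w \<in> ?L" for w using z[OF span_base[OF that]] by (simp add: orthogonal_def)
    have Tx: "T x = a *\<^sub>R y + b *\<^sub>R z" unfolding x by (rule T[OF y' z'])
    let ?d = "?\<pi> (T x) - a *\<^sub>R y"
    have dL: "?d \<in> ?L" using pL[OF that] y' by (intro subspace_diff subspace_scale subspace_annihilator)
    have d: "?d = b *\<^sub>R z - (T x - ?\<pi> (T x))" unfolding Tx by simp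
    have "?d \<bullet> ?d = 0"
      using zL[OF that dL] z'[OF dL] by (subst d) (simp add: inner_diff_left)
    then have p: "?\<pi> (T x) = a *\<^sub>R y" by simp
    then have "T x - ?\<pi> (T x) = b *\<^sub>R z" by (simp add: Tx)
    then have "x = (1 / a) *\<^sub>R ?\<pi> (T x) + (1 / b) *\<^sub>R (T x - ?\<pi> (T x))"
      unfolding p using a b x by simp
    then show ?thesis using scale[OF that, of "1 / a" "1 / b"] a b by simp
  qed
  have F: "std_gaussian_density (T x) * (ennreal (h (T x)) * indicator R (T x)) =
      std_gaussian_density x * indicator R x" for x
  proof (cases "x \<in> R")
    case False
    then show ?thesis using bwd by (auto simp: indicator_def)
  next
    case True
    let ?p = "?\<pi> x" and ?z = "x - ?\<pi> x"
    have Tx: "T x = a *\<^sub>R ?p + b *\<^sub>R ?z" by (rule fwd[OF True])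
    have \<pi>T: "?\<pi> (T x) = a *\<^sub>R ?p"
      unfolding Tx using a b by (intro closest_point_cone_scale[OF C]) auto
    have TR: "T x \<in> R" unfolding Tx using True a b by (intro scale) auto
    have "?p \<bullet> ?z = 0" using closest_point_cone(2)[OF C, of x] by (simp add: inner_commute)
    then have orth: "orthogonal ?p ?z" "orthogonal (a *\<^sub>R ?p) (b *\<^sub>R ?z)" by (simp_all add: orthogonal_def)
    have nx: "(norm x)\<^sup>2 = (norm ?p)\<^sup>2 + (norm ?z)\<^sup>2"
      using norm_add_Pythagorean[OF orth(1)] by simp
    have nT: "(norm (T x))\<^sup>2 = a\<^sup>2 * (norm ?p)\<^sup>2 + b\<^sup>2 * (norm ?z)\<^sup>2"
      unfolding Tx using norm_add_Pythagorean[OF orth(2)] by (simp add: power_mult_distrib)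
    have "- (norm (T x))\<^sup>2 / 2 + (- s * (norm (?\<pi> (T x)))\<^sup>2 - t * (norm (T x - ?\<pi> (T x)))\<^sup>2)
        = - (a\<^sup>2 * (1 + 2 * s)) * (norm ?p)\<^sup>2 / 2 - (b\<^sup>2 * (1 + 2 * t)) * (norm ?z)\<^sup>2 / 2"
    proof -
      have n1: "(norm (?\<pi> (T x)))\<^sup>2 = a\<^sup>2 * (norm ?p)\<^sup>2" unfolding \<pi>T by (simp add: power_mult_distrib)
      have "T x - ?\<pi> (T x) = b *\<^sub>R ?z" unfolding \<pi>T by (simp only: Tx add_diff_cancel_left')
      then have n2: "(norm (T x - ?\<pi> (T x)))\<^sup>2 = b\<^sup>2 * (norm ?z)\<^sup>2" by (simp add: power_mult_distrib)
      show ?thesis unfolding nT n1 n2 by (simp add: field_simps)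
    qed
    also have "\<dots> = - (norm x)\<^sup>2 / 2" by (simp add: a b nx)
    finally have "exp (- (norm (T x))\<^sup>2 / 2) * h (T x) = exp (- (norm x)\<^sup>2 / 2)"
      unfolding h_def by (simp only: exp_add[symmetric])
    then show ?thesis
      using True TR by (simp add: std_gaussian_density_eq h_def mult.assoc flip: ennreal_mult)
  qed
  have "(\<integral>\<^sup>+x. ennreal (h x) * indicator R x \<partial>std_gaussian)
      = (\<integral>\<^sup>+x. std_gaussian_density x * (ennreal (h x) * indicator R x) \<partial>lborel)"
    unfolding std_gaussian_def by (rule nn_integral_density) measurable
  also have "\<dots> = ennreal (a ^ dim ?L * b ^ (DIM('a) - dim ?L)) *
      (\<integral>\<^sup>+x. std_gaussian_density (T x) * (ennreal (h (T x)) * indicator R (T x)) \<partial>lborel)"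
    by (rule T_int) measurable
  also have "(\<integral>\<^sup>+x. std_gaussian_density (T x) * (ennreal (h (T x)) * indicator R (T x)) \<partial>lborel)
      = emeasure std_gaussian R"
    unfolding F std_gaussian_def by (rule emeasure_density[symmetric]) measurable
  finally show ?thesis by (simp add: a_def b_def)
qed

lemma conic_laplace_integrand_le_1:
  fixes s t p q :: real
  assumes "s \<ge> 0" "t \<ge> 0"
  shows "exp (- (s * p\<^sup>2) - t * q\<^sup>2) \<le> 1"
proof -
  have "0 \<le> s * p\<^sup>2" "0 \<le> t * q\<^sup>2" using assms by simp_all
  then show ?thesis by simp
qed

lemma integrable_conic_laplace:
  fixes C :: "'a::euclidean_space set"
  assumes C: "closed_convex_cone C" and "s \<ge> 0" "t \<ge> 0"
  shows "integrable std_gaussian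
    (\<lambda>x. exp (- s * (norm (closest_point C x))\<^sup>2 - t * (norm (x - closest_point C x))\<^sup>2))"
proof -
  interpret prob_space "std_gaussian :: 'a measure" by (rule prob_space_std_gaussian)
  note [measurable] = borel_measurable_closest_point[OF C]
  show ?thesis
    by (intro integrable_const_bound[of _ 1]) (use assms in \<open>auto intro!: AE_I2 conic_laplace_integrand_le_1 simp del: exp_le_one_iff\<close>)
qed

text \<open>Each point has exactly one set of tight constraints at its projection, so the event
  splits disjointly over the subsets of \<open>U\<close>; subsets that never occur contribute the
  empty set.\<close>

lemma polyhedral_intrinsic_volume_eq:
  fixes U :: "'a::euclidean_space set"
  assumes U: "finite U" and P: "P = {x. \<forall>u\<in>U. 0 \<le> u \<bullet> x}"
  shows "polyhedral_intrinsic_volume P k = (\<Sum>I\<in>{I\<in>Pow U. dim (annihilator I) = k}.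
    measure std_gaussian {x. active U (closest_point P x) = I})"
proof -
  interpret prob_space "std_gaussian :: 'a measure" by (rule prob_space_std_gaussian)
  have C: "closed_convex_cone P"
    using polyhedral_coneI[OF U P] by (rule polyhedral_cone_imp_closed_convex_cone)
  have "{x. \<exists>F. cone_face F P \<and> dim F = k \<and> closest_point P x \<in> rel_interior F}
      = (\<Union>I\<in>{I\<in>Pow U. dim (annihilator I) = k}. {x. active U (closest_point P x) = I})"
    unfolding ex_cone_face_dim_iff[OF U P closest_point_cone(1)[OF C]] by (auto simp: active_def)
  then show ?thesis
    unfolding polyhedral_intrinsic_volume_def
    using U sets_active_region[OF U _ C]
    by (simp only:) (intro finite_measure_finite_Union, auto simp: disjoint_family_on_def)
qed

text \<open>Each region contributes its Gaussian measure times a factor depending only on the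
  dimension of its face; collecting equal dimensions produces the intrinsic volumes.\<close>

lemma conic_laplace_polyhedral:
  fixes P :: "'a::euclidean_space set"
  assumes "polyhedral_cone P" and s: "s \<ge> 0" and t: "t \<ge> 0"
  shows "conic_laplace P s t = (\<Sum>k\<le>DIM('a). polyhedral_intrinsic_volume P k *
    ((1 / sqrt (1 + 2 * s)) ^ k * (1 / sqrt (1 + 2 * t)) ^ (DIM('a) - k)))"
proof -
  interpret prob_space "std_gaussian :: 'a measure" by (rule prob_space_std_gaussian)
  obtain U where U: "finite U" and P: "P = {x. \<forall>u\<in>U. 0 \<le> u \<bullet> x}"
    using assms(1) by (rule polyhedral_coneE)
  have C: "closed_convex_cone P"
    using assms(1) by (rule polyhedral_cone_imp_closed_convex_cone)
  note [measurable] = borel_measurable_closest_point[OF C]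
  define h where "h x = exp (- s * (norm (closest_point P x))\<^sup>2 - t * (norm (x - closest_point P x))\<^sup>2)" for x
  define R where "R I = {x. active U (closest_point P x) = I}" for I
  define c where "c k = (1 / sqrt (1 + 2 * s)) ^ k * (1 / sqrt (1 + 2 * t)) ^ (DIM('a) - k)" for k
  have [measurable]: "h \<in> borel_measurable borel" unfolding h_def by measurable
  have R [measurable]: "R I \<in> sets borel" if "I \<in> Pow U" for I
    unfolding R_def using that by (intro sets_active_region[OF U _ C]) auto
  have c: "c k \<ge> 0" for k using s t by (simp add: c_def)
  have sum1: "(\<Sum>I\<in>Pow U. ennreal (h x) * indicator (R I) x) = ennreal (h x)" for x
  proof -
    \<comment> \<open>The regions partition the space, so a single summand survives.\<close>
    have "(\<Sum>I\<in>Pow U. ennreal (h x) * indicator (R I) x) = (\<Sum>I\<in>{active U (closest_point P x)}. ennreal (h x) * indicator (R I) x)"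
      using U by (intro sum.mono_neutral_right) (auto simp: R_def active_def indicator_def)
    then show ?thesis by (simp add: R_def)
  qed
  have "ennreal (conic_laplace P s t) = (\<integral>\<^sup>+x. ennreal (h x) \<partial>std_gaussian)"
    unfolding conic_laplace_def h_def
    by (intro nn_integral_eq_integral[symmetric] integrable_conic_laplace[OF C s t]) auto
  also have "\<dots> = (\<integral>\<^sup>+x. (\<Sum>I\<in>Pow U. ennreal (h x) * indicator (R I) x) \<partial>std_gaussian)"
    by (simp add: sum1)
  also have "\<dots> = (\<Sum>I\<in>Pow U. (\<integral>\<^sup>+x. ennreal (h x) * indicator (R I) x \<partial>std_gaussian))"
    by (intro nn_integral_sum) measurable
  also have "\<dots> = (\<Sum>I\<in>Pow U. ennreal (c (dim (annihilator I)) * measure std_gaussian (R I)))"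
  proof (intro sum.cong refl)
    fix I assume "I \<in> Pow U"
    then show "(\<integral>\<^sup>+x. ennreal (h x) * indicator (R I) x \<partial>std_gaussian)
        = ennreal (c (dim (annihilator I)) * measure std_gaussian (R I))"
      using nn_integral_active_region[OF U P _ s t, of I] c
      by (simp add: h_def R_def c_def[symmetric] emeasure_eq_measure ennreal_mult)
  qed
  also have "\<dots> = ennreal (\<Sum>I\<in>Pow U. c (dim (annihilator I)) * measure std_gaussian (R I))"
    using c by (intro sum_ennreal) auto
  finally have "conic_laplace P s t = (\<Sum>I\<in>Pow U. c (dim (annihilator I)) * measure std_gaussian (R I))"
    using c by (subst (asm) ennreal_inj) (auto simp: conic_laplace_def intro!: sum_nonneg)
  also have "\<dots> = (\<Sum>k\<le>DIM('a). \<Sum>I\<in>{I\<in>Pow U. dim (annihilator I) = k}. c (dim (annihilator I)) * measure std_gaussian (R I))"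
    using U by (intro sum.group[symmetric]) (auto simp: dim_subset_UNIV)
  also have "\<dots> = (\<Sum>k\<le>DIM('a). polyhedral_intrinsic_volume P k * c k)"
    unfolding polyhedral_intrinsic_volume_eq[OF U P] R_def sum_distrib_right
    by (intro sum.cong refl) (auto simp: mult.commute)
  finally show ?thesis by (simp add: c_def)
qed

lemma conic_laplace_tendsto:
  fixes C :: "'a::euclidean_space set"
  assumes C: "closed_convex_cone C" and P: "\<And>i. closed_convex_cone (P i)"
    and lim: "(\<lambda>i. conic_hausdorff_dist (P i) C) \<longlonglongrightarrow> 0" and s: "s \<ge> 0" and t: "t \<ge> 0"
  shows "(\<lambda>i. conic_laplace (P i) s t) \<longlonglongrightarrow> conic_laplace C s t"
proof -
  interpret prob_space "std_gaussian :: 'a measure" by (rule prob_space_std_gaussian)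
  note [measurable] = borel_measurable_closest_point[OF C] borel_measurable_closest_point[OF P]
  show ?thesis
    unfolding conic_laplace_def
  proof (rule integral_dominated_convergence[where w="\<lambda>_. 1"])
    show "AE x in std_gaussian. (\<lambda>i. exp (- s * (norm (closest_point (P i) x))\<^sup>2 - t * (norm (x - closest_point (P i) x))\<^sup>2))
      \<longlonglongrightarrow> exp (- s * (norm (closest_point C x))\<^sup>2 - t * (norm (x - closest_point C x))\<^sup>2)"
      by (intro AE_I2 tendsto_intros closest_point_conic_hausdorff_tendsto[OF C P lim])
  qed (use conic_laplace_integrand_le_1[OF s t] in \<open>auto simp del: exp_le_one_iff\<close>)
qed

section \<open>Intrinsic volumes\<close>

lemma conic_laplace_0: "conic_laplace (C :: 'a::euclidean_space set) 0 0 = 1"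
proof -
  interpret prob_space "std_gaussian :: 'a measure" by (rule prob_space_std_gaussian)
  show ?thesis by (simp add: conic_laplace_def prob_space[simplified])
qed

text \<open>At t = 0 the transform of a polyhedral cone is a polynomial in a = 1/sqrt(1 + 2s) whose
  coefficients are the intrinsic volumes. Convergence of the transforms therefore forces convergence
  of the coefficients to a limit common to all approximating sequences, and the definite description
  is well defined.\<close>

lemma intrinsic_volume_limit:
  fixes C :: "'a::euclidean_space set" and P :: "nat \<Rightarrow> 'a set"
  assumes C: "closed_convex_cone C" and np: "\<not> polyhedral_cone C" and k: "k \<le> DIM('a)"
    and P: "\<And>i. polyhedral_cone (P i)" "(\<lambda>i. conic_hausdorff_dist (P i) C) \<longlonglongrightarrow> 0"
  shows "(\<lambda>i. polyhedral_intrinsic_volume (P i) k) \<longlonglongrightarrow> intrinsic_volume C k"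
proof -
  \<comment> \<open>The solution s of 1/sqrt(1 + 2s) = a; it is nonnegative for a in (0,1].\<close>
  let ?s = "\<lambda>a::real. (1 / a\<^sup>2 - 1) / 2"
  have "infinite {0<..(1::real)}" by (simp add: infinite_Ioc)
  from sum_coeff_convergent[OF this, of "DIM('a)" "\<lambda>a. conic_laplace C (?s a) 0"]
  obtain w where w: "\<forall>v :: nat \<Rightarrow> nat \<Rightarrow> real.
      (\<forall>a\<in>{0<..1}. (\<lambda>i. \<Sum>k\<le>DIM('a). v i k * a ^ k) \<longlonglongrightarrow> conic_laplace C (?s a) 0) \<longrightarrow>
      (\<forall>k\<le>DIM('a). (\<lambda>i. v i k) \<longlonglongrightarrow> w k)"
    by blast
  have lim: "(\<lambda>i. polyhedral_intrinsic_volume (Q i) k) \<longlonglongrightarrow> w k"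
    if Q: "\<And>i. polyhedral_cone (Q i)" "(\<lambda>i. conic_hausdorff_dist (Q i) C) \<longlonglongrightarrow> 0" for Q :: "nat \<Rightarrow> 'a set"
  proof (rule w[rule_format, OF _ k])
    fix a :: real assume a: "a \<in> {0<..1}"
    then have s: "?s a \<ge> 0" by (simp add: power_le_one)
    have "1 + 2 * ?s a = (1 / a)\<^sup>2" by (simp add: power_divide diff_divide_distrib)
    then have "1 / sqrt (1 + 2 * ?s a) = a" using a by (simp only: real_sqrt_abs) simp
    then have "(\<Sum>k\<le>DIM('a). polyhedral_intrinsic_volume (Q i) k * a ^ k) = conic_laplace (Q i) (?s a) 0" for i
      using conic_laplace_polyhedral[OF Q(1) s order_refl] by simp
    then show "(\<lambda>i. \<Sum>k\<le>DIM('a). polyhedral_intrinsic_volume (Q i) k * a ^ k) \<longlonglongrightarrow> conic_laplace C (?s a) 0"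
      using conic_laplace_tendsto[OF C polyhedral_cone_imp_closed_convex_cone[OF Q(1)] Q(2) s order_refl]
      by simp
  qed
  have "intrinsic_volume C k = w k"
    unfolding intrinsic_volume_def using np
  proof (simp, intro the_equality allI impI)
    fix Q :: "nat \<Rightarrow> 'a set"
    assume "(\<forall>i. polyhedral_cone (Q i)) \<and> (\<lambda>i. conic_hausdorff_dist (Q i) C) \<longlonglongrightarrow> 0"
    then show "(\<lambda>i. polyhedral_intrinsic_volume (Q i) k) \<longlonglongrightarrow> w k" using lim by blast
  next
    fix v assume "\<forall>P. (\<forall>i. polyhedral_cone (P i)) \<and> (\<lambda>i. conic_hausdorff_dist (P i) C) \<longlonglongrightarrow> 0 \<longrightarrow>
      (\<lambda>i. polyhedral_intrinsic_volume (P i) k) \<longlonglongrightarrow> v"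
    \<comment> \<open>Uniqueness of the described value rests on the existence of an approximating
      sequence, here the given \<open>P\<close>.\<close>
    then have "(\<lambda>i. polyhedral_intrinsic_volume (P i) k) \<longlonglongrightarrow> v" using P by blast
    then show "v = w k" using lim[OF P] by (rule LIMSEQ_unique)
  qed
  then show ?thesis using lim[OF P] by simp
qed

text \<open>Both facts hold for polyhedral cones and pass to the limit along an approximating
  sequence.\<close>

lemma
  fixes C :: "'a::euclidean_space set"
  assumes C: "closed_convex_cone C"
  shows intrinsic_volume_nonneg: "k \<le> DIM('a) \<Longrightarrow> 0 \<le> intrinsic_volume C k"
    and conic_laplace_eq_sum: "s \<ge> 0 \<Longrightarrow> t \<ge> 0 \<Longrightarrow> conic_laplace C s t =
      (\<Sum>k\<le>DIM('a). intrinsic_volume C k * ((1 / sqrt (1 + 2 * s)) ^ k * (1 / sqrt (1 + 2 * t)) ^ (DIM('a) - k)))"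
proof -
  have poly_nonneg: "0 \<le> polyhedral_intrinsic_volume Q k" for Q :: "'a set" and k
    by (simp add: polyhedral_intrinsic_volume_def)
  obtain P where P: "\<And>i::nat. polyhedral_cone (P i)" "(\<lambda>i. conic_hausdorff_dist (P i) C) \<longlonglongrightarrow> 0"
    by (rule ex_polyhedral_cones_tendsto[OF C]) blast
  note lim = intrinsic_volume_limit[OF C _ _ P]
  show "0 \<le> intrinsic_volume C k" if "k \<le> DIM('a)"
  proof (cases "polyhedral_cone C")
    case False
    show ?thesis
      by (rule LIMSEQ_le_const[OF lim[OF False that]]) (use poly_nonneg in blast)
  qed (simp add: intrinsic_volume_def poly_nonneg)
  show "conic_laplace C s t =
      (\<Sum>k\<le>DIM('a). intrinsic_volume C k * ((1 / sqrt (1 + 2 * s)) ^ k * (1 / sqrt (1 + 2 * t)) ^ (DIM('a) - k)))"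
    if st: "s \<ge> 0" "t \<ge> 0"
  proof (cases "polyhedral_cone C")
    case True
    then show ?thesis using conic_laplace_polyhedral[OF True st] by (simp add: intrinsic_volume_def)
  next
    case False
    have "(\<lambda>i. conic_laplace (P i) s t) \<longlonglongrightarrow> conic_laplace C s t"
      by (rule conic_laplace_tendsto[OF C polyhedral_cone_imp_closed_convex_cone[OF P(1)] P(2) st])
    moreover have "(\<lambda>i. conic_laplace (P i) s t) \<longlonglongrightarrow>
      (\<Sum>k\<le>DIM('a). intrinsic_volume C k * ((1 / sqrt (1 + 2 * s)) ^ k * (1 / sqrt (1 + 2 * t)) ^ (DIM('a) - k)))"
      unfolding conic_laplace_polyhedral[OF P(1) st]
      by (intro tendsto_sum tendsto_mult_right lim False) simp
    ultimately show ?thesis by (rule LIMSEQ_unique)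
  qed
qed

text \<open>At s = t = 0 the transform is the total Gaussian mass.\<close>

lemma sum_intrinsic_volume:
  fixes C :: "'a::euclidean_space set"
  assumes "closed_convex_cone C"
  shows "(\<Sum>k\<le>DIM('a). intrinsic_volume C k) = 1"
  using conic_laplace_eq_sum[OF assms, of 0 0] by (simp add: conic_laplace_0)

lemma pmf_intrinsic_volume_pmf:
  fixes C :: "'a::euclidean_space set"
  assumes C: "closed_convex_cone C"
  shows "pmf (intrinsic_volume_pmf C) k = (if k \<le> DIM('a) then intrinsic_volume C k else 0)"
  unfolding intrinsic_volume_pmf_def
proof (rule pmf_embed_pmf)
  show "0 \<le> (if k \<le> DIM('a) then intrinsic_volume C k else 0)" for k
    using intrinsic_volume_nonneg[OF C] by simp
  have "(\<integral>\<^sup>+k. ennreal (if k \<le> DIM('a) then intrinsic_volume C k else 0) \<partial>count_space UNIV)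
      = (\<Sum>k\<le>DIM('a). ennreal (intrinsic_volume C k))"
    by (subst nn_integral_count_space'[of "{..DIM('a)}"]) auto
  also have "\<dots> = 1"
    using intrinsic_volume_nonneg[OF C] by (subst sum_ennreal) (simp_all add: sum_intrinsic_volume[OF C])
  finally show "(\<integral>\<^sup>+k. ennreal (if k \<le> DIM('a) then intrinsic_volume C k else 0) \<partial>count_space UNIV) = 1" .
qed

lemma expectation_intrinsic_volume_pmf:
  fixes C :: "'a::euclidean_space set" and f :: "nat \<Rightarrow> real"
  assumes C: "closed_convex_cone C"
  shows "measure_pmf.expectation (intrinsic_volume_pmf C) f = (\<Sum>k\<le>DIM('a). intrinsic_volume C k * f k)"
  by (subst integral_measure_pmf_real[of "{..DIM('a)}"])
     (auto simp: pmf_intrinsic_volume_pmf[OF C] set_pmf_eq mult.commute split: if_splits)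

section \<open>Comparison of the variances\<close>

lemma variance_sum:
  fixes v m :: "'b \<Rightarrow> real"
  assumes "sum v K = 1"
  shows "(\<Sum>k\<in>K. v k * (m k - (\<Sum>k\<in>K. v k * m k))\<^sup>2) = (\<Sum>k\<in>K. v k * (m k)\<^sup>2) - (\<Sum>k\<in>K. v k * m k)\<^sup>2"
proof -
  define \<mu> where "\<mu> = (\<Sum>k\<in>K. v k * m k)"
  have "(\<Sum>k\<in>K. v k * (m k - \<mu>)\<^sup>2) = (\<Sum>k\<in>K. v k * (m k)\<^sup>2 - 2 * \<mu> * (v k * m k) + \<mu>\<^sup>2 * v k)"
    by (simp add: power2_diff algebra_simps)
  also have "\<dots> = (\<Sum>k\<in>K. v k * (m k)\<^sup>2) - 2 * \<mu> * \<mu> + \<mu>\<^sup>2 * 1"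
    by (simp only: sum.distrib sum_subtractf sum_distrib_left[symmetric] \<mu>_def[symmetric] assms)
  finally show ?thesis by (simp add: \<mu>_def power2_eq_square)
qed

text \<open>On the axes the transform has exponents k for \<open>X\<close> and d - k for
  \<open>Y\<close>. The moments m and m(m+2) give Var X = Var V + 2 E V, and the same for
  \<open>Y\<close> with d - V, which has the variance of V.\<close>

lemma
  fixes C :: "'a::euclidean_space set"
  assumes C: "closed_convex_cone C"
  defines "X \<equiv> \<lambda>x. (norm (closest_point C x))\<^sup>2" and "Y \<equiv> \<lambda>x. (norm (x - closest_point C x))\<^sup>2"
  shows stat_dim_eq_expectation: "stat_dim C = (\<integral>x. X x \<partial>std_gaussian)"
    and variance_intrinsic_volume:
      "prob_space.variance std_gaussian X - 2 * (\<integral>x. X x \<partial>std_gaussian)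
        = measure_pmf.variance (intrinsic_volume_pmf C) real"
    and variance_intrinsic_volume_residual:
      "prob_space.variance std_gaussian Y - 2 * (\<integral>x. Y x \<partial>std_gaussian)
        = measure_pmf.variance (intrinsic_volume_pmf C) real"
proof -
  interpret G: prob_space "std_gaussian :: 'a measure" by (rule prob_space_std_gaussian)
  note [measurable] = borel_measurable_closest_point[OF C]
  let ?K = "{..DIM('a)}" and ?v = "intrinsic_volume C"
  have [measurable]: "X \<in> borel_measurable std_gaussian" "Y \<in> borel_measurable std_gaussian"
    unfolding X_def Y_def by measurable
  have nonneg: "0 \<le> X x" "0 \<le> Y x" for x by (simp_all add: X_def Y_def)
  note one = sum_intrinsic_volume[OF C]
  have variance: "G.variance Z - 2 * (\<integral>x. Z x \<partial>std_gaussian) = (\<Sum>k\<le>DIM('a). ?v k * (real (m k) - (\<Sum>k\<le>DIM('a). ?v k * m k))\<^sup>2)"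
    if Z: "integrable std_gaussian Z" "(\<integral>x. Z x \<partial>std_gaussian) = (\<Sum>k\<le>DIM('a). ?v k * m k)"
      "integrable std_gaussian (\<lambda>x. (Z x)\<^sup>2)" "(\<integral>x. (Z x)\<^sup>2 \<partial>std_gaussian) = (\<Sum>k\<le>DIM('a). ?v k * (m k * (m k + 2)))"
    for Z and m :: "nat \<Rightarrow> nat"
  proof -
    \<comment> \<open>The excess of m(m+2) over m^2 is the source of the term with twice the
      mean.\<close>
    have "(\<Sum>k\<le>DIM('a). ?v k * (m k * (m k + 2))) = (\<Sum>k\<le>DIM('a). ?v k * (real (m k))\<^sup>2) + 2 * (\<Sum>k\<le>DIM('a). ?v k * m k)"
      by (simp add: sum_distrib_left sum.distrib[symmetric] power2_eq_square algebra_simps)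
    then show ?thesis
      unfolding variance_sum[OF one] G.variance_eq[OF Z(1,3)] Z(4) by (simp add: Z(2))
  qed
  have X: "(\<integral>x. exp (- s * X x) \<partial>std_gaussian) = (\<Sum>k\<in>?K. ?v k * (1 / sqrt (1 + 2 * s)) ^ k)" if "s \<ge> 0" for s
    using conic_laplace_eq_sum[OF C that order_refl] by (simp add: conic_laplace_def X_def)
  have Y: "(\<integral>x. exp (- s * Y x) \<partial>std_gaussian) = (\<Sum>k\<in>?K. ?v k * (1 / sqrt (1 + 2 * s)) ^ (DIM('a) - k))" if "s \<ge> 0" for s
    using conic_laplace_eq_sum[OF C order_refl that] by (simp add: conic_laplace_def Y_def)
  have EX: "(\<integral>x. X x \<partial>std_gaussian) = (\<Sum>k\<le>DIM('a). ?v k * k)"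
    by (rule laplace_transform_moments(2)[OF prob_space_std_gaussian _ nonneg(1) _ one X]) simp_all
  have sd: "stat_dim C = (\<Sum>k\<le>DIM('a). ?v k * k)"
    by (simp add: stat_dim_def expectation_intrinsic_volume_pmf[OF C])
  show "stat_dim C = (\<integral>x. X x \<partial>std_gaussian)" by (simp add: EX sd)
  have varV: "measure_pmf.variance (intrinsic_volume_pmf C) real =
      (\<Sum>k\<le>DIM('a). ?v k * (real k - (\<Sum>k\<le>DIM('a). ?v k * k))\<^sup>2)"
    by (simp add: expectation_intrinsic_volume_pmf[OF C])
  show "G.variance X - 2 * (\<integral>x. X x \<partial>std_gaussian) = measure_pmf.variance (intrinsic_volume_pmf C) real"
    unfolding varV
    by (rule variance; rule laplace_transform_moments[OF prob_space_std_gaussian _ nonneg(1) _ one X]) simp_all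
  have "G.variance Y - 2 * (\<integral>x. Y x \<partial>std_gaussian) =
      (\<Sum>k\<le>DIM('a). ?v k * (real (DIM('a) - k) - (\<Sum>k\<le>DIM('a). ?v k * real (DIM('a) - k)))\<^sup>2)"
    by (rule variance; rule laplace_transform_moments[OF prob_space_std_gaussian _ nonneg(2) _ one Y]) simp_all
  \<comment> \<open>The truncated difference is a true one for k at most d. The mean of d - V is d -
    E V, so deviations from the mean change only their sign.\<close>
  also have "(\<Sum>k\<le>DIM('a). ?v k * real (DIM('a) - k)) = (\<Sum>k\<le>DIM('a). real DIM('a) * ?v k - ?v k * k)"
    by (intro sum.cong refl) (simp add: of_nat_diff algebra_simps)
  also have "\<dots> = DIM('a) - (\<Sum>k\<le>DIM('a). ?v k * k)"
    by (simp add: sum_subtractf sum_distrib_left[symmetric] one)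
  also have "(\<Sum>k\<le>DIM('a). ?v k * (real (DIM('a) - k) - (DIM('a) - (\<Sum>k\<le>DIM('a). ?v k * k)))\<^sup>2) =
      measure_pmf.variance (intrinsic_volume_pmf C) real"
    unfolding varV by (intro sum.cong refl) (simp add: of_nat_diff power2_commute)
  finally show "G.variance Y - 2 * (\<integral>x. Y x \<partial>std_gaussian) = measure_pmf.variance (intrinsic_volume_pmf C) real" .
qed

theorem proposition4p4:
  fixes C :: "(real ^ 'n) set" and M :: "'w measure" and g :: "'w \<Rightarrow> real ^ 'n"
  assumes "closed_convex_cone C"
    and "prob_space M"
    and "distributed M lborel g std_gaussian_density"
  shows "measure_pmf.variance (intrinsic_volume_pmf C) real
           = prob_space.variance M (\<lambda>\<omega>. (norm (closest_point C (g \<omega>)))\<^sup>2) - 2 * stat_dim C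
       \<and> prob_space.variance M (\<lambda>\<omega>. (norm (closest_point C (g \<omega>)))\<^sup>2) - 2 * stat_dim C
           = prob_space.variance M (\<lambda>\<omega>. (norm (closest_point (polar_cone C) (g \<omega>)))\<^sup>2)
             - 2 * stat_dim (polar_cone C)
       \<and> prob_space.variance M (\<lambda>\<omega>. (norm (closest_point (polar_cone C) (g \<omega>)))\<^sup>2)
             - 2 * stat_dim (polar_cone C)
           = measure_pmf.variance (intrinsic_volume_pmf (polar_cone C)) real"
proof -
  have C: "closed_convex_cone C" and D: "closed_convex_cone (polar_cone C)"
    using assms(1) closed_convex_cone_polar_cone by auto
  have g [measurable]: "g \<in> borel_measurable M"
    using distributed_measurable[OF assms(3)] by simp
  have distr: "distr M lborel g = std_gaussian"
    using distributed_distr_eq_density[OF assms(3)] by (simp add: std_gaussian_def)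
  \<comment> \<open>All expectations depend only on the law of \<open>g\<close>, so they are
    computed under \<open>std_gaussian\<close> itself.\<close>
  have transfer: "(\<integral>\<omega>. f (g \<omega>) \<partial>M) = (\<integral>x. f x \<partial>std_gaussian)"
    if "f \<in> borel_measurable borel" for f :: "real ^ 'n \<Rightarrow> real"
    unfolding distr[symmetric] using that by (intro integral_distr[symmetric]) auto
  have variance: "prob_space.variance M (\<lambda>\<omega>. (norm (closest_point K (g \<omega>)))\<^sup>2)
      = prob_space.variance std_gaussian (\<lambda>x. (norm (closest_point K x))\<^sup>2)"
    if "closed_convex_cone K" for K :: "(real ^ 'n) set"
  proof -
    note [measurable] = borel_measurable_closest_point[OF that]
    have "(\<integral>\<omega>. (norm (closest_point K (g \<omega>)))\<^sup>2 \<partial>M) = (\<integral>x. (norm (closest_point K x))\<^sup>2 \<partial>std_gaussian)"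
      by (rule transfer) measurable
    then show ?thesis by simp (rule transfer, measurable)
  qed
  \<comment> \<open>The squared norm of the projection onto the polar is \<open>Y\<close> for
    \<open>C\<close> and also \<open>X\<close> for the polar cone. Its variance minus twice its mean
    is therefore the variance of both intrinsic volume variables, without comparing the two families
    of intrinsic volumes directly.\<close>
  show ?thesis
    unfolding variance[OF C] variance[OF D] stat_dim_eq_expectation[OF C] stat_dim_eq_expectation[OF D]
    using variance_intrinsic_volume[OF C] variance_intrinsic_volume[OF D]
      variance_intrinsic_volume_residual[OF C]
    by (simp only: closest_point_polar_cone[OF C])
qed

end
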